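(* Let $m\ge 2$ and $q\ge 2$ be integers and let $A$ be a primitive $m\times m$ matrix with entries in $\{0,1\}$. Let $$X_A := \{(x_k)_{k=1}^\infty:\ x_k\in\{0,\dots,m-1\},\ A(x_k,x_{qk})=1 \text{ for all } k\ge 1\}\subset\Sigma_m.$$ (i) We have $$\dim_H(X_A) = \frac{q-1}{q}\log_m \sum_{i=0}^{m-1} t_i,$$ where $(t_i)_{i=0}^{m-1}$ is the unique vector with $t_i>1$ and $t_i^q=\sum_{j=0}^{m-1}A(i,j)t_j$ for all $i$. (ii) The Minkowski dimension of $X_A$ exists and equals $$\dim_M(X_A) = (q-1)^2\sum_{k=1}^\infty \frac{\log_m (A^{k-1}\overline{1},\overline{1})}{q^{k+1}},$$ where $\overline{1}=(1,\dots,1)^T\in\mathbb{R}^m$ and $(\cdot,\cdot)$ is the standard inner product. Moreover, $\dim_H(X_A)=\dim_M(X_A)$ if and only if $\overline{1}$ is an eigenvector of $A$ (i.e. all row sums of $A$ are equal).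
   Context: $\Sigma_m=\{0,\dots,m-1\}^{\mathbb N}$ with the metric $\varrho((x_k),(y_k)) = m^{-\min\{n:\ x_n\ne y_n\}+1}$; Hausdorff and Minkowski dimensions are taken with respect to this metric. A non-negative matrix is primitive if some power is strictly positive. $\log_m$ denotes logarithm to base $m$. *)

theory Defs
  imports "HOL-Analysis.Analysis" "Jordan_Normal_Form.Char_Poly"
begin

text \<open>Sequences (x_k) indexed by k = 1,2,...; represented as functions nat => nat,
  with the unused coordinate 0 normalised to 0.\<close>
definition Sigma_seq :: "nat \<Rightarrow> (nat \<Rightarrow> nat) set" where
  "Sigma_seq m = {x. x 0 = 0 \<and> (\<forall>k\<ge>1. x k < m)}"

definition rho :: "nat \<Rightarrow> (nat \<Rightarrow> nat) \<Rightarrow> (nat \<Rightarrow> nat) \<Rightarrow> real" where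
  "rho m x y = (if x = y then 0 else real m powr (- real (LEAST n. x n \<noteq> y n) + 1))"

definition sdiam :: "nat \<Rightarrow> (nat \<Rightarrow> nat) set \<Rightarrow> real" where
  "sdiam m U = (if U = {} then 0 else Sup ((\<lambda>(x, y). rho m x y) ` (U \<times> U)))"

definition hausdorff_content :: "nat \<Rightarrow> real \<Rightarrow> real \<Rightarrow> (nat \<Rightarrow> nat) set \<Rightarrow> ennreal" where
  "hausdorff_content m s \<delta> E =
     (INF U \<in> {U :: nat \<Rightarrow> (nat \<Rightarrow> nat) set.
                 (\<forall>i. U i \<subseteq> Sigma_seq m \<and> sdiam m (U i) \<le> \<delta>) \<and> E \<subseteq> (\<Union>i. U i)}.
        (\<Sum>i. ennreal (sdiam m (U i) powr s)))"

definition hausdorff_measure :: "nat \<Rightarrow> real \<Rightarrow> (nat \<Rightarrow> nat) set \<Rightarrow> ennreal" where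
  "hausdorff_measure m s E = (SUP \<delta> \<in> {0<..}. hausdorff_content m s \<delta> E)"

definition hausdorff_dim :: "nat \<Rightarrow> (nat \<Rightarrow> nat) set \<Rightarrow> real" where
  "hausdorff_dim m E = Inf {s :: real. 0 < s \<and> hausdorff_measure m s E = 0}"

definition cover_num :: "nat \<Rightarrow> real \<Rightarrow> (nat \<Rightarrow> nat) set \<Rightarrow> nat" where
  "cover_num m \<delta> E = (LEAST n. \<exists>U :: nat \<Rightarrow> (nat \<Rightarrow> nat) set.
      (\<forall>i<n. U i \<subseteq> Sigma_seq m \<and> sdiam m (U i) \<le> \<delta>) \<and> E \<subseteq> (\<Union>i<n. U i))"

definition minkowski_dim_eq :: "nat \<Rightarrow> (nat \<Rightarrow> nat) set \<Rightarrow> real \<Rightarrow> bool" where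
  "minkowski_dim_eq m E D \<longleftrightarrow>
     ((\<lambda>\<delta>. ln (real (cover_num m \<delta> E)) / - ln \<delta>) \<longlongrightarrow> D) (at_right 0)"

definition primitive_mat :: "real mat \<Rightarrow> bool" where
  "primitive_mat A \<longleftrightarrow> (\<forall>i<dim_row A. \<forall>j<dim_col A. A $$ (i,j) \<ge> 0) \<and>
     (\<exists>k. \<forall>i<dim_row A. \<forall>j<dim_col A. (A ^\<^sub>m k) $$ (i,j) > 0)"

definition ones_vec :: "nat \<Rightarrow> real vec" where
  "ones_vec n = vec n (\<lambda>_. 1)"

definition X_A :: "nat \<Rightarrow> nat \<Rightarrow> real mat \<Rightarrow> (nat \<Rightarrow> nat) set" where
  "X_A m q A = {x \<in> Sigma_seq m. \<forall>k\<ge>1. A $$ (x k, x (q * k)) = 1}"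

end

theory Submission
  imports Defs
begin

text \<open>
  The condition on \<open>x\<close> decouples along the chains \<open>i, q i, q\<^sup>2 i, \<dots>\<close> with \<open>q\<close> not dividing \<open>i\<close>, and
  about \<open>n (q - 1)\<^sup>2 / q\<^bsup>k+1\<^esup>\<close> of the chains have exactly \<open>k\<close> members up to \<open>n\<close>. Counting walks on
  each chain gives the Minkowski dimension.

  For the Hausdorff dimension put on every chain the Markov measure with initial distribution
  \<open>t\<^sub>j / T\<close>, \<open>T = \<Sum>\<^sub>j t\<^sub>j\<close>, and transition probabilities \<open>A(i,j) t\<^sub>j / t\<^sub>i\<^sup>q\<close>. Writing
  \<open>S\<^sub>n = \<Sum>\<^sub>k\<^sub>\<le>\<^sub>n ln t(x\<^sub>k)\<close>, the cylinder of length \<open>n\<close> around \<open>x\<close> has measure \<open>P\<close> with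
  \<open>- ln P = (n - \<lfloor>n/q\<rfloor>) ln T - S\<^sub>n + q S\<^bsub>\<lfloor>n/q\<rfloor>\<^esub>\<close>. Along \<open>n = q\<^sup>j\<close> the correction \<open>S\<^sub>n - q S\<^bsub>n/q\<^esub>\<close>, divided
  by \<open>n\<close>, telescopes for every \<open>x\<close>; this gives the upper bound. The correction is a martingale with controlled
  increments up to its mean, which is \<open>o(n)\<close>; an exponential moment estimate and the mass distribution principle
  give the lower bound. Finally, both dimensions are the same weighted sum, one of
  the entropies of the Markov chain and one of the maximal entropies, so they agree only if \<open>t\<close> is constant.
\<close>

subsection \<open>Chains of a multiplicative shift\<close>

text \<open>The system for t comes from a discounted optimisation. Chains with more than l members
  have density proportional to \<open>1 / q ^ l\<close>, so the entropy of the l-th step of a chain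
  counts with that weight. If \<open>ln (t i)\<close> denotes the best discounted entropy still
  available after letter i, maximising over the next step gives
  \<open>q * ln (t i) = ln (\<Sum>j<m. a i j * t j)\<close>, and maximising over the first letter
  gives the value \<open>ln T\<close>. The maximisers are the transition and initial probabilities
  of the Markov chain. No measure on the infinite product is constructed. Only masses of finite
  words occur; they are consistent under truncation, and compactness reduces a countable cover by
  cylinders to a finite one, which is tested on words of one common length. Primitivity enters
  through two consequences: every row is nonzero, so words extend, and from every letter the walks
  eventually branch, so \<open>t i > 1\<close>.\<close>

definition chain_roots :: "nat \<Rightarrow> nat \<Rightarrow> nat set" where
  "chain_roots q n = {k \<in> {1..n}. \<not> q dvd k}"

definition chain_len :: "nat \<Rightarrow> nat \<Rightarrow> nat \<Rightarrow> nat" where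
  "chain_len q n k = card {l. q ^ l * k \<le> n}"

text \<open>A root gets the dummy parent 0, where every word carries the letter 0. One family of
  kernels then covers both initial and transition weights; the kernels used below ignore the parent
  letter at a root.\<close>

definition parent :: "nat \<Rightarrow> nat \<Rightarrow> nat" where
  "parent q k = (if q dvd k then k div q else 0)"

lemma finite_chain_roots [simp]: "finite (chain_roots q n)"
  by (simp add: chain_roots_def)

lemma multiples_upto:
  fixes q n :: nat
  assumes "q \<ge> 1"
  shows "{k \<in> {1..n}. q dvd k} = (*) q ` {1..n div q}"
proof -
  have "k \<in> {1..n} \<and> q dvd k \<longleftrightarrow> k \<in> (*) q ` {1..n div q}" for k
  proof
    assume k: "k \<in> {1..n} \<and> q dvd k"
    then have eq: "k = q * (k div q)" by simp
    have "k div q \<noteq> 0"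
    proof
      assume "k div q = 0"
      with eq have "k = 0" by (metis mult_0_right)
      with k show False by simp
    qed
    with k have "k div q \<in> {1..n div q}" by (simp add: div_le_mono)
    with eq show "k \<in> (*) q ` {1..n div q}" by (rule image_eqI)
  next
    assume "k \<in> (*) q ` {1..n div q}"
    then obtain j where j: "k = q * j" "j \<in> {1..n div q}" by (rule imageE)
    then have "j * q \<le> n" using assms less_eq_div_iff_mult_less_eq[of q j n] by simp
    then show "k \<in> {1..n} \<and> q dvd k" using j assms by (simp add: mult.commute)
  qed
  then show ?thesis by blast
qed

text \<open>Stated for an arbitrary commutative monoid, since it is used for sums of logarithms as
  well as for products of weights.\<close>

lemma (in comm_monoid_set) split_by_parent:
  assumes "q \<ge> 1"
  shows "F (\<lambda>k. if q dvd k then h (k div q) else g k) {1..n} =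
         F h {1..n div q} \<^bold>* F g (chain_roots q n)"
proof -
  have un: "{1..n} = {k \<in> {1..n}. q dvd k} \<union> chain_roots q n"
    and dj: "{k \<in> {1..n}. q dvd k} \<inter> chain_roots q n = {}"
    by (auto simp: chain_roots_def)
  have inj: "inj_on ((*) q) {1..n div q}" using assms by (auto simp: inj_on_def)
  have "F (\<lambda>k. if q dvd k then h (k div q) else g k) {1..n} =
      F (\<lambda>k. if q dvd k then h (k div q) else g k) {k \<in> {1..n}. q dvd k} \<^bold>*
      F (\<lambda>k. if q dvd k then h (k div q) else g k) (chain_roots q n)"
    by (subst un, rule union_disjoint) (use dj in auto)
  also have "F (\<lambda>k. if q dvd k then h (k div q) else g k) {k \<in> {1..n}. q dvd k} = F h {1..n div q}"
    unfolding multiples_upto[OF assms] using assms by (subst reindex[OF inj]) (auto intro!: cong)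
  also have "F (\<lambda>k. if q dvd k then h (k div q) else g k) (chain_roots q n) = F g (chain_roots q n)"
    by (rule cong) (auto simp: chain_roots_def)
  finally show ?thesis .
qed

lemma card_chain_roots:
  assumes "q \<ge> 1"
  shows "card (chain_roots q n) = n - n div q"
proof -
  have "(\<Sum>k\<in>{1..n}. if q dvd k then (1::nat) else 1) = (\<Sum>k\<in>{1..n div q}. 1) + (\<Sum>k\<in>chain_roots q n. 1)"
    by (rule sum.split_by_parent[OF assms, of "\<lambda>_. 1" "\<lambda>_. 1"])
  then show ?thesis by simp
qed

lemma chain_len_set:
  fixes q k n :: nat
  assumes "q \<ge> 2" "k \<ge> 1"
  shows "finite {l. q ^ l * k \<le> n}"
proof (rule finite_subset)
  show "{l. q ^ l * k \<le> n} \<subseteq> {..n}"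
  proof
    fix l assume "l \<in> {l. q ^ l * k \<le> n}"
    moreover have "l < q ^ l" using assms by (intro less_exp[THEN less_le_trans] power_mono) auto
    moreover have "q ^ l \<le> q ^ l * k" using assms by simp
    ultimately show "l \<in> {..n}" unfolding mem_Collect_eq atMost_iff by linarith
  qed
qed simp

lemma chain_len_eq_0: "n < k \<Longrightarrow> q \<ge> 2 \<Longrightarrow> chain_len q n k = 0"
proof -
  assume "n < k" "q \<ge> 2"
  have "q ^ l * k > n" for l
  proof -
    have "1 * k \<le> q ^ l * k" using \<open>q \<ge> 2\<close> by (intro mult_le_mono1) simp
    with \<open>n < k\<close> show ?thesis by linarith
  qed
  then have "{l. q ^ l * k \<le> n} = {}" by (auto simp: not_le)
  then show ?thesis by (simp add: chain_len_def)
qed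

lemma chain_len_Suc:
  assumes "q \<ge> 2" "k \<ge> 1" "k \<le> n"
  shows "chain_len q n k = Suc (chain_len q n (q * k))"
proof -
  have "{l. q ^ l * k \<le> n} = insert 0 (Suc ` {l. q ^ l * (q * k) \<le> n})"
  proof (intro equalityI subsetI)
    fix l assume "l \<in> {l. q ^ l * k \<le> n}"
    then show "l \<in> insert 0 (Suc ` {l. q ^ l * (q * k) \<le> n})"
      by (cases l) (auto simp: algebra_simps)
  qed (use assms in \<open>auto simp: algebra_simps\<close>)
  moreover have "finite {l. q ^ l * (q * k) \<le> n}" using assms by (intro chain_len_set) auto
  ultimately show ?thesis by (simp add: chain_len_def card_image)
qed

lemma less_chain_len_iff:
  assumes "q \<ge> 2" "k \<ge> 1"
  shows "l < chain_len q n k \<longleftrightarrow> q ^ l * k \<le> n"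
  using assms(2)
proof (induction l arbitrary: k)
  case 0
  then show ?case using assms chain_len_eq_0[of n k q] chain_len_Suc[of q k n]
    by (cases "k \<le> n") auto
next
  case (Suc l)
  show ?case
  proof (cases "k \<le> n")
    case True
    then show ?thesis using Suc.IH[of "q * k"] Suc.prems assms
      by (simp add: chain_len_Suc algebra_simps)
  next
    case False
    have "1 * k \<le> q ^ Suc l * k" using assms by (intro mult_le_mono1) simp
    with False have "q ^ Suc l * k > n" by linarith
    with False show ?thesis using assms by (simp add: chain_len_eq_0)
  qed
qed

lemma power_mult_le_iff:
  fixes q :: nat
  assumes "q \<ge> 1"
  shows "q ^ l * k \<le> n \<longleftrightarrow> k \<le> n div q ^ l"
  using assms by (simp add: less_eq_div_iff_mult_less_eq mult.commute)

lemma chain_len_le: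
  assumes "q \<ge> 2" "k \<ge> 1"
  shows "chain_len q n k \<le> n"
proof (rule ccontr)
  assume "\<not> ?thesis"
  then have "q ^ n * k \<le> n" using less_chain_len_iff[OF assms, of n n] by simp
  moreover have "n < q ^ n" using assms by (intro less_exp[THEN less_le_trans] power_mono) auto
  moreover have "q ^ n * 1 \<le> q ^ n * k" using assms by (intro mult_le_mono2) auto
  ultimately show False by simp
qed

text \<open>Double counting of the pairs (k, l) with \<open>q ^ l * k \<le> n\<close>. The range
  \<open>l < n\<close> loses nothing because no chain has more than n members.\<close>

lemma sum_chain_len_swap:
  fixes g :: "nat \<Rightarrow> real"
  assumes "q \<ge> 2" "finite K" "\<And>k. k \<in> K \<Longrightarrow> k \<ge> 1"
  shows "(\<Sum>k\<in>K. \<Sum>l<chain_len q n k. g l) = (\<Sum>l<n. g l * real (card {k \<in> K. k \<le> n div q ^ l}))"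
proof -
  have "(\<Sum>k\<in>K. \<Sum>l<chain_len q n k. g l) = (\<Sum>k\<in>K. \<Sum>l<n. if k \<le> n div q ^ l then g l else 0)"
  proof (rule sum.cong)
    fix k assume k: "k \<in> K"
    have "l < chain_len q n k \<longleftrightarrow> l < n \<and> k \<le> n div q ^ l" for l
      using less_chain_len_iff[OF assms(1) assms(3)[OF k], of l n] power_mult_le_iff[of q l k n] assms(1)
        chain_len_le[OF assms(1) assms(3)[OF k], of n] by linarith
    then have "{..<chain_len q n k} = {l \<in> {..<n}. k \<le> n div q ^ l}" by auto
    then show "(\<Sum>l<chain_len q n k. g l) = (\<Sum>l<n. if k \<le> n div q ^ l then g l else 0)"
      by (simp only: sum.inter_filter[OF finite_lessThan])
  qed simp
  also have "\<dots> = (\<Sum>l<n. \<Sum>k\<in>K. if k \<le> n div q ^ l then g l else 0)" by (rule sum.swap)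
  also have "\<dots> = (\<Sum>l<n. g l * real (card {k \<in> K. k \<le> n div q ^ l}))"
    using assms(2) by (simp add: sum.inter_filter[symmetric] mult.commute)
  finally show ?thesis .
qed

definition chain_sum :: "nat \<Rightarrow> (nat \<Rightarrow> real) \<Rightarrow> nat \<Rightarrow> real" where
  "chain_sum q g n = (\<Sum>k\<in>chain_roots q n. \<Sum>l<chain_len q n k. g l)"

text \<open>A chain has more than l members up to n exactly if its root is at most
  \<open>n div q ^ l\<close>, so the weight of \<open>g l\<close> is a number of roots.\<close>

lemma chain_sum_eq:
  assumes "q \<ge> 2"
  shows "chain_sum q g n = (\<Sum>l<n. g l * real (n div q ^ l - n div q ^ Suc l))"
proof -
  have "{k \<in> chain_roots q n. k \<le> n div q ^ l} = chain_roots q (n div q ^ l)" for l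
    by (auto simp: chain_roots_def intro: le_trans)
  moreover have "card (chain_roots q (n div q ^ l)) = n div q ^ l - n div q ^ Suc l" for l
    using assms by (simp only: card_chain_roots power_Suc2 div_mult2_eq)
  moreover have "chain_sum q g n = (\<Sum>l<n. g l * real (card {k \<in> chain_roots q n. k \<le> n div q ^ l}))"
    unfolding chain_sum_def using assms by (intro sum_chain_len_swap) (auto simp: chain_roots_def)
  ultimately show ?thesis by (simp only:)
qed

text \<open>Dominated convergence for series: after division by n the l-th coefficient tends to
  \<open>1 / q ^ l - 1 / q ^ Suc l\<close>, and the l-th term is dominated by
  \<open>B * (1 / q) ^ l\<close> uniformly in n.\<close>

lemma chain_sum_limit:
  fixes g :: "nat \<Rightarrow> real"
  assumes q: "q \<ge> 2" and bound: "\<And>l. \<bar>g l\<bar> \<le> B"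
  shows "(\<lambda>n. chain_sum q g n / real n) \<longlonglongrightarrow> (1 - 1 / real q) * (\<Sum>l. g l / real q ^ l)"
proof -
  define f where "f = (\<lambda>l n. g l * (real (n div q ^ l - n div q ^ Suc l) / real n))"
  have B: "B \<ge> 0" using bound[of 0] by linarith
  have qdiv: "real (n div q ^ l) = of_int \<lfloor>real n / real q ^ l\<rfloor>" for n l
    by (simp add: floor_divide_of_nat_eq flip: of_nat_power)
  have fl: "f l n = g l * ((of_int \<lfloor>real n / real q ^ l\<rfloor> - of_int \<lfloor>real n / real q ^ Suc l\<rfloor>) / real n)" for l n
  proof -
    have "n div q ^ Suc l \<le> n div q ^ l" using q by (intro div_le_mono2) auto
    then have "real (n div q ^ l - n div q ^ Suc l) = real (n div q ^ l) - real (n div q ^ Suc l)"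
      by (rule of_nat_diff)
    then show ?thesis unfolding f_def qdiv by simp
  qed
  have fsum: "(\<Sum>l. f l n) = chain_sum q g n / real n" for n
  proof -
    have "(\<Sum>l. f l n) = (\<Sum>l<n. f l n)"
    proof (rule suminf_finite)
      fix l assume "l \<notin> {..<n}"
      moreover have "l < q ^ l" using q by (intro less_exp[THEN less_le_trans] power_mono) auto
      ultimately have "n div q ^ l = 0" by simp
      then show "f l n = 0" by (simp add: f_def)
    qed simp
    then show ?thesis by (simp add: chain_sum_eq[OF q] f_def sum_divide_distrib)
  qed
  have lim: "(f l \<longlongrightarrow> g l * (1 / real q ^ l - 1 / real q ^ Suc l)) sequentially" for l
  proof -
    have fll: "(\<lambda>n. of_int \<lfloor>real n / c\<rfloor> / real n) \<longlonglongrightarrow> 1 / c" if c: "c > 0" for c :: real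
    proof (rule tendsto_sandwich)
      show "\<forall>\<^sub>F n in sequentially. 1 / c - 1 / real n \<le> of_int \<lfloor>real n / c\<rfloor> / real n"
      proof (rule eventually_sequentiallyI[of 1])
        fix n :: nat assume "1 \<le> n"
        then have "1 / c - 1 / real n = (real n / c - 1) / real n" by (simp add: field_simps)
        also have "\<dots> \<le> of_int \<lfloor>real n / c\<rfloor> / real n"
          by (intro divide_right_mono) linarith+
        finally show "1 / c - 1 / real n \<le> of_int \<lfloor>real n / c\<rfloor> / real n" .
      qed
      show "\<forall>\<^sub>F n in sequentially. of_int \<lfloor>real n / c\<rfloor> / real n \<le> 1 / c"
      proof (rule eventually_sequentiallyI[of 1])
        fix n :: nat assume "1 \<le> n"
        have "of_int \<lfloor>real n / c\<rfloor> / real n \<le> (real n / c) / real n" by (intro divide_right_mono) linarith+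
        then show "of_int \<lfloor>real n / c\<rfloor> / real n \<le> 1 / c" using \<open>1 \<le> n\<close> by simp
      qed
      show "(\<lambda>n. 1 / c - 1 / real n) \<longlonglongrightarrow> 1 / c"
        using tendsto_diff[OF tendsto_const lim_1_over_n, of "1 / c"] by simp
    qed simp
    have "(\<lambda>n. g l * (of_int \<lfloor>real n / real q ^ l\<rfloor> / real n - of_int \<lfloor>real n / real q ^ Suc l\<rfloor> / real n))
        \<longlonglongrightarrow> g l * (1 / real q ^ l - 1 / real q ^ Suc l)"
      using q by (intro tendsto_mult tendsto_diff tendsto_const fll) auto
    moreover have "f l = (\<lambda>n. g l * (of_int \<lfloor>real n / real q ^ l\<rfloor> / real n - of_int \<lfloor>real n / real q ^ Suc l\<rfloor> / real n))"
      by (rule ext) (simp only: fl diff_divide_distrib)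
    ultimately show ?thesis by simp
  qed
  have le: "norm (f l n) \<le> B * (1 / real q) ^ l" for l n
  proof -
    have "real (n div q ^ l - n div q ^ Suc l) \<le> real n / real q ^ l"
      using of_nat_div_le_of_nat[of n "q ^ l", where 'a = real]
      by (simp only: of_nat_power)
    then have "real (n div q ^ l - n div q ^ Suc l) / real n \<le> (1 / real q) ^ l"
      by (cases "n = 0") (simp_all add: power_one_over divide_le_eq mult.commute inverse_eq_divide)
    then have "\<bar>g l\<bar> * (real (n div q ^ l - n div q ^ Suc l) / real n) \<le> B * (1 / real q) ^ l"
      using bound[of l] B by (intro mult_mono) auto
    then show ?thesis by (simp add: f_def abs_mult)
  qed
  have "((\<lambda>n. \<Sum>l. f l n) \<longlongrightarrow> (\<Sum>l. g l * (1 / real q ^ l - 1 / real q ^ Suc l))) sequentially"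
  proof -
    have "\<forall>\<^sub>F (l, n) in at_top \<times>\<^sub>F sequentially. norm (f l n) \<le> B * (1 / real q) ^ l"
      using le by (intro always_eventually) auto
    moreover have "summable (\<lambda>l. B * (1 / real q) ^ l)"
      using q by (intro summable_mult summable_geometric) auto
    ultimately show ?thesis 
      using tannerys_theorem[where a = f and b = "\<lambda>l. g l * (1 / real q ^ l - 1 / real q ^ Suc l)"
          and M = "\<lambda>l. B * (1 / real q) ^ l" and F = sequentially, OF lim] sequentially_bot by blast
  qed
  also have "(\<lambda>l. g l * (1 / real q ^ l - 1 / real q ^ Suc l)) = (\<lambda>l. (1 - 1 / real q) * (g l / real q ^ l))"
    by (rule ext) (simp add: diff_divide_distrib right_diff_distrib left_diff_distrib)
  also have "(\<Sum>l. (1 - 1 / real q) * (g l / real q ^ l)) = (1 - 1 / real q) * (\<Sum>l. g l / real q ^ l)"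
  proof (rule suminf_mult)
    show "summable (\<lambda>l. g l / real q ^ l)"
    proof (rule summable_comparison_test')
      show "summable (\<lambda>l. B * (1 / real q) ^ l)" using q by (auto intro!: summable_mult summable_geometric)
      show "norm (g l / real q ^ l) \<le> B * (1 / real q) ^ l" for l
        using bound[of l] by (simp add: power_divide divide_right_mono)
    qed
  qed
  finally show ?thesis by (simp add: fsum)
qed

text \<open>Chain lengths have geometric tails, so their squares sum to O(n); this keeps the later
  exponential moment bound linear in n. The constant 6 is the series of
  \<open>(2 * l + 1) / 2 ^ l\<close>, obtained by writing a square as a sum of odd numbers and
  replacing q by 2.\<close>

lemma sum_chain_len_square_le:
  assumes "q \<ge> 2"
  shows "(\<Sum>k=1..n. real (chain_len q n k) ^ 2) \<le> 6 * real n"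
proof -
  have sq: "real r ^ 2 = (\<Sum>l<r. 2 * real l + 1)" for r
    by (induction r) (auto simp: power2_eq_square algebra_simps)
  have "(\<Sum>k=1..n. real (chain_len q n k) ^ 2) = (\<Sum>l<n. (2 * real l + 1) * real (card {k \<in> {1..n}. k \<le> n div q ^ l}))"
    unfolding sq by (rule sum_chain_len_swap) (use assms in auto)
  also have "\<dots> \<le> (\<Sum>l<n. (2 * real l + 1) * (real n / 2 ^ l))"
  proof (intro sum_mono mult_left_mono)
    fix l
    have "card {k \<in> {1..n}. k \<le> n div q ^ l} \<le> card {1..n div q ^ l}" by (intro card_mono) auto
    also have "\<dots> = n div q ^ l" by simp
    also have "\<dots> \<le> n div 2 ^ l" using assms by (intro div_le_mono2 power_mono) auto
    finally have "real (card {k \<in> {1..n}. k \<le> n div q ^ l}) \<le> real (n div 2 ^ l)" by simp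
    then show "real (card {k \<in> {1..n}. k \<le> n div q ^ l}) \<le> real n / 2 ^ l"
      using of_nat_div_le_of_nat[of n "2 ^ l", where 'a = real] by simp
  qed auto
  also have "\<dots> = real n * (6 - (4 * real n + 6) / 2 ^ n)"
  proof -
    have "(\<Sum>l<N. (2 * real l + 1) / 2 ^ l) = 6 - (4 * real N + 6) / 2 ^ N" for N
    proof (induction N)
      case (Suc N)
      then show ?case by (simp add: add_divide_distrib diff_divide_distrib algebra_simps)
    qed simp
    moreover have "(\<Sum>l<n. (2 * real l + 1) * (real n / 2 ^ l)) = real n * (\<Sum>l<n. (2 * real l + 1) / 2 ^ l)"
      by (simp add: sum_distrib_left algebra_simps)
    ultimately show ?thesis by simp
  qed
  also have "\<dots> \<le> real n * 6" by (intro mult_left_mono) auto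
  finally show ?thesis by (simp add: mult.commute)
qed

subsection \<open>Words and cylinder weights\<close>

definition words :: "nat \<Rightarrow> nat \<Rightarrow> (nat \<Rightarrow> nat) set" where
  "words m n = {u. u 0 = 0 \<and> (\<forall>k\<in>{1..n}. u k < m) \<and> (\<forall>k>n. u k = 0)}"

definition truncate :: "nat \<Rightarrow> (nat \<Rightarrow> nat) \<Rightarrow> nat \<Rightarrow> nat" where
  "truncate n x = (\<lambda>k. if k \<le> n then x k else 0)"

text \<open>If all kernels have row sums 1, this is the probability of the cylinder of length n
  around u.\<close>

definition weight :: "nat \<Rightarrow> (nat \<Rightarrow> nat \<Rightarrow> nat \<Rightarrow> real) \<Rightarrow> nat \<Rightarrow> (nat \<Rightarrow> nat) \<Rightarrow> real" where
  "weight q w n u = (\<Prod>k=1..n. w k (u (parent q k)) (u k))"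

lemma parent_le: "parent q k \<le> k"
  by (simp add: parent_def)

lemma parent_less: "q \<ge> 2 \<Longrightarrow> k \<ge> 1 \<Longrightarrow> parent q k < k"
  by (simp add: parent_def)

lemma weight_cong:
  assumes "\<And>k. k \<le> n \<Longrightarrow> u k = v k"
  shows "weight q w n u = weight q w n v"
  unfolding weight_def
proof (rule prod.cong)
  fix k assume "k \<in> {1..n}"
  then have "k \<le> n" "parent q k \<le> n" using parent_le[of q k] by auto
  then show "w k (u (parent q k)) (u k) = w k (v (parent q k)) (v k)" by (simp add: assms)
qed simp

lemma weight_truncate: "l \<le> n \<Longrightarrow> weight q w l (truncate n u) = weight q w l u"
  by (rule weight_cong) (simp add: truncate_def)

lemma truncate_word:
  assumes "x \<in> Sigma_seq m"
  shows "truncate n x \<in> words m n"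
  using assms by (auto simp: Sigma_seq_def words_def truncate_def)

lemma truncate_words_id: "u \<in> words m n \<Longrightarrow> truncate n u = u"
  by (auto simp: words_def truncate_def)

lemma words_less: "u \<in> words m n \<Longrightarrow> m > 0 \<Longrightarrow> u k < m"
  by (cases "k = 0"; cases "k \<le> n") (auto simp: words_def)

lemma words_0: "words m 0 = {\<lambda>_. 0}"
proof (intro equalityI subsetI)
  fix u assume "u \<in> words m 0"
  then have "u k = 0" for k by (cases "k = 0") (auto simp: words_def)
  then show "u \<in> {\<lambda>_. 0}" by auto
qed (auto simp: words_def)

lemma bij_betw_words_Suc:
  "bij_betw (\<lambda>(u, b). u(Suc n := b)) (words m n \<times> {..<m}) (words m (Suc n))"
proof (rule bij_betw_byWitness[where f' = "\<lambda>u. (truncate n u, u (Suc n))"])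
  show "\<forall>ub\<in>words m n \<times> {..<m}. (\<lambda>u. (truncate n u, u (Suc n))) ((\<lambda>(u, b). u(Suc n := b)) ub) = ub"
    by (auto simp: words_def truncate_def fun_eq_iff)
  show "\<forall>u\<in>words m (Suc n). (\<lambda>(u, b). u(Suc n := b)) (truncate n u, u (Suc n)) = u"
    by (auto simp: words_def truncate_def fun_eq_iff)
  show "(\<lambda>(u, b). u(Suc n := b)) ` (words m n \<times> {..<m}) \<subseteq> words m (Suc n)"
    by (auto simp: words_def)
  show "(\<lambda>u. (truncate n u, u (Suc n))) ` words m (Suc n) \<subseteq> words m n \<times> {..<m}"
    by (auto simp: words_def truncate_def)
qed

lemma finite_words [simp]: "finite (words m n)"
proof (induction n)
  case 0
  then show ?case by (simp add: words_0)
next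
  case (Suc n)
  then have "finite (words m n \<times> {..<m})" by simp
  with bij_betw_words_Suc[of n m] show ?case using bij_betw_finite by blast
qed

lemma sum_words_Suc:
  fixes F :: "(nat \<Rightarrow> nat) \<Rightarrow> real"
  shows "(\<Sum>u\<in>words m (Suc n). F u) = (\<Sum>u\<in>words m n. \<Sum>b<m. F (u(Suc n := b)))"
  using sum.reindex_bij_betw[OF bij_betw_words_Suc, of F n m]
  by (simp add: case_prod_unfold sum.cartesian_product)

lemma weight_Suc:
  assumes "q \<ge> 2"
  shows "weight q w (Suc n) (u(Suc n := b)) = weight q w n u * w (Suc n) (u (parent q (Suc n))) b"
proof -
  have "weight q w n (u(Suc n := b)) = weight q w n u" by (rule weight_cong) simp
  moreover have "parent q (Suc n) \<noteq> Suc n" using parent_less[OF assms, of "Suc n"] by simp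
  ultimately show ?thesis by (simp add: weight_def)
qed

text \<open>Letters are summed out from the last one backwards. The letter at \<open>Suc n\<close>
  occurs in its own factor only, because parents precede their children, and the bound C is uniform
  in the parent letter.\<close>

lemma sum_weight_le:
  assumes "q \<ge> 2" "m > 0"
    and "\<And>k x b. x < m \<Longrightarrow> b < m \<Longrightarrow> w k x b \<ge> 0" "\<And>k x. 1 \<le> k \<Longrightarrow> k \<le> n \<Longrightarrow> x < m \<Longrightarrow> (\<Sum>b<m. w k x b) \<le> C k"
  shows "(\<Sum>u\<in>words m n. weight q w n u) \<le> (\<Prod>k=1..n. C k)"
  using assms(4)
proof (induction n)
  case 0
  then show ?case by (simp add: words_0 weight_def)
next
  case (Suc n)
  have "0 \<le> (\<Sum>b<m. w (Suc n) 0 b)" using assms(2,3) by (intro sum_nonneg) auto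
  also have "\<dots> \<le> C (Suc n)" using Suc.prems[of "Suc n" 0] assms(2) by simp
  finally have C: "C (Suc n) \<ge> 0" .
  have "(\<Sum>u\<in>words m (Suc n). weight q w (Suc n) u) =
      (\<Sum>u\<in>words m n. weight q w n u * (\<Sum>b<m. w (Suc n) (u (parent q (Suc n))) b))"
    unfolding sum_words_Suc by (simp add: weight_Suc[OF assms(1)] sum_distrib_left)
  also have "\<dots> \<le> (\<Sum>u\<in>words m n. weight q w n u * C (Suc n))"
  proof (intro sum_mono mult_left_mono Suc.prems)
    fix u assume "u \<in> words m n"
    then show "u (parent q (Suc n)) < m" using assms(2) by (rule words_less)
    show "0 \<le> weight q w n u" unfolding weight_def
      using assms(2,3) words_less[OF \<open>u \<in> words m n\<close>] by (intro prod_nonneg) blast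
  qed auto
  also have "\<dots> \<le> (\<Prod>k=1..n. C k) * C (Suc n)"
    unfolding sum_distrib_right[symmetric] using Suc C by (intro mult_right_mono) auto
  finally show ?case by simp
qed

text \<open>Kolmogorov consistency of the word masses, the substitute for a measure on infinite
  sequences.\<close>

lemma sum_weight_marginal:
  assumes "q \<ge> 2" "m > 0" "l \<le> n"
    and "\<And>k x. 1 \<le> k \<Longrightarrow> k \<le> n \<Longrightarrow> x < m \<Longrightarrow> (\<Sum>b<m. w k x b) = 1"
  shows "(\<Sum>u\<in>words m n. F (truncate l u) * weight q w n u) = (\<Sum>u\<in>words m l. F u * weight q w l u)"
  using assms(3,4)
proof (induction n)
  case 0
  then show ?case by (simp add: words_0 truncate_def)
next
  case (Suc n)
  show ?case
  proof (cases "l = Suc n")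
    case True
    then show ?thesis by (intro sum.cong) (auto simp: truncate_words_id)
  next
    case False
    with Suc.prems have "l \<le> n" by simp
    then have tr: "truncate l (u(Suc n := b)) = truncate l u" for u b by (auto simp: truncate_def)
    have "(\<Sum>u\<in>words m (Suc n). F (truncate l u) * weight q w (Suc n) u) =
      (\<Sum>u\<in>words m n. F (truncate l u) * weight q w n u * (\<Sum>b<m. w (Suc n) (u (parent q (Suc n))) b))"
      unfolding sum_words_Suc by (simp add: weight_Suc[OF assms(1)] sum_distrib_left tr mult.assoc)
    also have "\<dots> = (\<Sum>u\<in>words m n. F (truncate l u) * weight q w n u)"
      using Suc.prems assms(2) by (intro sum.cong) (auto simp: words_less)
    also have "\<dots> = (\<Sum>u\<in>words m l. F u * weight q w l u)"
      using Suc.IH \<open>l \<le> n\<close> Suc.prems by auto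
    finally show ?thesis .
  qed
qed

lemma sum_weight_eq_1:
  assumes "q \<ge> 2" "m > 0"
    and "\<And>k x. 1 \<le> k \<Longrightarrow> k \<le> n \<Longrightarrow> x < m \<Longrightarrow> (\<Sum>b<m. w k x b) = 1"
  shows "(\<Sum>u\<in>words m n. weight q w n u) = 1"
  using sum_weight_marginal[where F = "\<lambda>_. 1", OF assms(1,2) le0 assms(3)]
  by (simp add: words_0 weight_def)

section \<open>Exponential moments of bounded variables\<close>

text \<open>The bound holds for all real x, without a smallness condition, and its linear term
  vanishes in the mean for a centred variable. For x between -1 and 0 it rests on
  \<open>(1 - y + y\<^sup>2) * (1 + y) = 1 + y * y * y\<close> with y = -x.\<close>

lemma exp_le_add_exp_square: "exp x \<le> x + exp (x\<^sup>2)" for x :: real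
proof -
  have e: "1 + x\<^sup>2 \<le> exp (x\<^sup>2)" by (rule exp_ge_add_one_self)
  consider "x > 1" | "x < -1" | "0 \<le> x" "x \<le> 1" | "-1 \<le> x" "x \<le> 0" by linarith
  then show ?thesis
  proof cases
    case 1
    then have "x \<le> x\<^sup>2" by (simp add: power2_eq_square)
    then have "exp x \<le> exp (x\<^sup>2)" by simp
    with 1 show ?thesis by linarith
  next
    case 2
    then have "1 * - x \<le> (- x) * (- x)" by (intro mult_right_mono) auto
    then have "- x \<le> x\<^sup>2" by (simp add: power2_eq_square)
    moreover have "exp x \<le> 1" using 2 by simp
    ultimately show ?thesis using e by linarith
  next
    case 3
    then show ?thesis using exp_bound[of x] e by linarith
  next
    case 4
    define y where "y = - x"
    have y: "0 \<le> y" "y \<le> 1" using 4 by (auto simp: y_def)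
    have "(1 - y + y\<^sup>2) * (1 + y) = 1 + y * y * y"
      by (simp add: algebra_simps power2_eq_square)
    then have "1 \<le> (1 - y + y\<^sup>2) * (1 + y)" using y by simp
    also have "\<dots> \<le> (1 - y + y\<^sup>2) * exp y"
      using y by (intro mult_left_mono exp_ge_add_one_self) (simp add: add_nonneg_nonneg)
    finally have "exp (- y) \<le> 1 - y + y\<^sup>2" by (simp add: exp_minus divide_simps mult.commute)
    then have "exp x \<le> 1 + x + x\<^sup>2" by (simp add: y_def)
    with e show ?thesis by linarith
  qed
qed

text \<open>A Hoeffding-type estimate: the deviation from the mean is at most 2R, and the linear
  term of \<open>exp_le_add_exp_square\<close> averages to 0.\<close>

lemma exp_moment_le:
  fixes p Y :: "'a \<Rightarrow> real"
  assumes "finite J" and p: "\<And>j. j \<in> J \<Longrightarrow> p j \<ge> 0" "sum p J = 1"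
    and Y: "\<And>j. j \<in> J \<Longrightarrow> \<bar>Y j\<bar> \<le> R"
  shows "(\<Sum>j\<in>J. p j * exp (\<theta> * (Y j - (\<Sum>i\<in>J. p i * Y i)))) \<le> exp (\<theta>\<^sup>2 * (2 * R)\<^sup>2)"
proof -
  define \<mu> where "\<mu> = (\<Sum>i\<in>J. p i * Y i)"
  have "\<bar>\<mu>\<bar> \<le> (\<Sum>i\<in>J. p i * R)"
    unfolding \<mu>_def using p Y by (intro order_trans[OF sum_abs] sum_mono) (auto simp: abs_mult intro: mult_left_mono)
  then have \<mu>: "\<bar>\<mu>\<bar> \<le> R" by (simp add: p(2) flip: sum_distrib_right)
  have R: "R \<ge> 0" using \<mu> by linarith
  have "(\<Sum>j\<in>J. p j * exp (\<theta> * (Y j - \<mu>))) \<le>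
      (\<Sum>j\<in>J. p j * (\<theta> * (Y j - \<mu>) + exp (\<theta>\<^sup>2 * (2 * R)\<^sup>2)))"
  proof (intro sum_mono mult_left_mono p)
    fix j assume j: "j \<in> J"
    have "\<bar>Y j - \<mu>\<bar> \<le> \<bar>2 * R\<bar>" using Y[OF j] \<mu> R by linarith
    then have "(Y j - \<mu>)\<^sup>2 \<le> (2 * R)\<^sup>2" by (rule abs_le_square_iff[THEN iffD1])
    then have "(\<theta> * (Y j - \<mu>))\<^sup>2 \<le> \<theta>\<^sup>2 * (2 * R)\<^sup>2" by (simp only: power_mult_distrib[of \<theta>]) (intro mult_left_mono, auto)
    then have "exp ((\<theta> * (Y j - \<mu>))\<^sup>2) \<le> exp (\<theta>\<^sup>2 * (2 * R)\<^sup>2)" by simp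
    then show "exp (\<theta> * (Y j - \<mu>)) \<le> \<theta> * (Y j - \<mu>) + exp (\<theta>\<^sup>2 * (2 * R)\<^sup>2)"
      using exp_le_add_exp_square[of "\<theta> * (Y j - \<mu>)"] by linarith
  qed
  also have "\<dots> = \<theta> * ((\<Sum>j\<in>J. p j * Y j) - sum p J * \<mu>) + sum p J * exp (\<theta>\<^sup>2 * (2 * R)\<^sup>2)"
    by (simp add: sum.distrib sum_subtractf sum_distrib_left sum_distrib_right algebra_simps)
  also have "\<dots> = exp (\<theta>\<^sup>2 * (2 * R)\<^sup>2)" by (simp add: p(2) \<mu>_def)
  finally show ?thesis by (simp add: \<mu>_def)
qed

subsection \<open>Cylinders, diameters and covers\<close>

definition cylinder :: "nat \<Rightarrow> nat \<Rightarrow> (nat \<Rightarrow> nat) \<Rightarrow> (nat \<Rightarrow> nat) set" where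
  "cylinder m n x = {y \<in> Sigma_seq m. \<forall>k\<le>n. y k = x k}"

lemma cylinder_subset: "cylinder m n x \<subseteq> Sigma_seq m"
  by (auto simp: cylinder_def)

text \<open>If N is the first index of disagreement, the distance is m to the power 1 - N, so the
  bound with exponent -n means N > n: the closed balls of this radius are the cylinders of length n,
  without a shift.\<close>

lemma rho_le_iff:
  assumes "m \<ge> 2"
  shows "rho m x y \<le> real m powr - real n \<longleftrightarrow> (\<forall>k\<le>n. x k = y k)"
proof (cases "x = y")
  case True
  then show ?thesis by (simp add: rho_def)
next
  case False
  define N where "N = (LEAST n. x n \<noteq> y n)"
  from False have ex: "\<exists>n. x n \<noteq> y n" by auto
  have N: "x N \<noteq> y N" unfolding N_def by (rule LeastI_ex[OF ex])
  have less: "x k = y k" if "k < N" for k using not_less_Least that unfolding N_def by blast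
  have "rho m x y \<le> real m powr - real n \<longleftrightarrow> - real N + 1 \<le> - real n"
    using False assms by (simp add: rho_def N_def)
  also have "\<dots> \<longleftrightarrow> n < N" by linarith
  also have "\<dots> \<longleftrightarrow> (\<forall>k\<le>n. x k = y k)"
    using N less by (meson le_less_trans not_le)
  finally show ?thesis .
qed

text \<open>Positive distances are integral powers of m, so none lies strictly between two
  consecutive powers and the radius may vary in that gap.\<close>

lemma rho_less_iff:
  assumes "m \<ge> 2" and "real m powr - real n \<le> \<delta>" "\<delta> < real m powr (1 - real n)"
  shows "rho m x y \<le> \<delta> \<longleftrightarrow> (\<forall>k\<le>n. x k = y k)"
proof
  assume le: "rho m x y \<le> \<delta>"
  have "rho m x y \<le> real m powr - real n"
  proof (cases "x = y")
    case False
    define N where "N = (LEAST n. x n \<noteq> y n)"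
    have "real m powr (- real N + 1) < real m powr (1 - real n)"
      using le False assms(3) by (simp add: rho_def N_def)
    then have "- real N + 1 < 1 - real n" using assms(1) by (subst (asm) powr_less_cancel_iff) auto
    then have "n < N" by simp
    then show ?thesis using False assms(1) by (simp add: rho_def flip: N_def)
  qed (simp add: rho_def)
  then show "\<forall>k\<le>n. x k = y k" using rho_le_iff[OF assms(1)] by blast
next
  assume "\<forall>k\<le>n. x k = y k"
  then show "rho m x y \<le> \<delta>" using rho_le_iff[OF assms(1), of x y n] assms(2) by auto
qed

lemma rho_nonneg: "rho m x y \<ge> 0"
  by (simp add: rho_def)

lemma rho_le_1:
  assumes "m \<ge> 2" "x \<in> Sigma_seq m" "y \<in> Sigma_seq m"
  shows "rho m x y \<le> 1"
  using rho_le_iff[OF assms(1), of x y 0] assms by (simp add: Sigma_seq_def)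

lemma rho_le_sdiam:
  assumes "m \<ge> 2" "U \<subseteq> Sigma_seq m" "x \<in> U" "y \<in> U"
  shows "rho m x y \<le> sdiam m U"
proof -
  have "bdd_above ((\<lambda>(x, y). rho m x y) ` (U \<times> U))"
    using rho_le_1[OF assms(1)] assms(2) by (intro bdd_aboveI[where M = 1]) auto
  then show ?thesis using assms(3,4) unfolding sdiam_def by (auto intro!: cSup_upper)
qed

lemma sdiam_le:
  assumes "d \<ge> 0" "\<And>x y. x \<in> U \<Longrightarrow> y \<in> U \<Longrightarrow> rho m x y \<le> d"
  shows "sdiam m U \<le> d"
  using assms unfolding sdiam_def by (auto intro!: cSup_least)

lemma sdiam_nonneg:
  assumes "m \<ge> 2" "U \<subseteq> Sigma_seq m"
  shows "sdiam m U \<ge> 0"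
proof (cases "U = {}")
  case False
  then obtain x where "x \<in> U" by auto
  then show ?thesis using rho_le_sdiam[OF assms \<open>x \<in> U\<close> \<open>x \<in> U\<close>] rho_nonneg[of m x x] by linarith
qed (simp add: sdiam_def)

lemma sdiam_cylinder_le:
  assumes "m \<ge> 2"
  shows "sdiam m (cylinder m n x) \<le> real m powr - real n"
  by (rule sdiam_le) (auto simp: rho_le_iff[OF assms] cylinder_def)

text \<open>If U has two points, n + 1 is the first coordinate on which U is not constant, and the
  cylinder has no more than the diameter of U to pay. A singleton has diameter 0 and lies in
  cylinders of every length; the slack \<eta> allows a finite n there.\<close>

lemma small_set_in_cylinder:
  assumes m: "m \<ge> 2" and U: "U \<subseteq> Sigma_seq m" "x \<in> U" and d: "sdiam m U \<le> real m powr - real n0"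
    and s: "s > 0" and \<eta>: "\<eta> > 0"
  obtains n where "n \<ge> n0" "U \<subseteq> cylinder m n x" "real m powr (- s * real n) \<le> sdiam m U powr s + \<eta>"
proof (cases "\<exists>y\<in>U. \<exists>z\<in>U. y \<noteq> z")
  case False
  then have sing: "U = {x}" using U by auto
  have "real m powr - s < real m powr 0" using m s by (subst powr_less_cancel_iff) auto
  then have "real m powr - s < 1" using m by simp
  then have "(\<lambda>n. (real m powr - s) ^ n) \<longlonglongrightarrow> 0" by (intro LIMSEQ_power_zero) simp
  moreover have "(real m powr - s) ^ n = real m powr (- s * real n)" for n
    using m by (simp add: powr_powr flip: powr_realpow)
  ultimately have "(\<lambda>n. real m powr (- s * real n)) \<longlonglongrightarrow> 0" by simp
  then have "\<forall>\<^sub>F n in sequentially. real m powr (- s * real n) < \<eta>"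
    using \<eta> by (rule order_tendstoD)
  with eventually_ge_at_top[of n0] have "\<forall>\<^sub>F n in sequentially. n0 \<le> n \<and> real m powr (- s * real n) < \<eta>"
    by (rule eventually_conj)
  then obtain n where "n0 \<le> n" "real m powr (- s * real n) < \<eta>"
    by (auto simp: eventually_sequentially)
  moreover have "real m powr (- s * real n) \<le> sdiam m U powr s + \<eta>"
    using \<open>real m powr (- s * real n) < \<eta>\<close> powr_ge_zero[of "sdiam m U" s] by linarith
  moreover have "U \<subseteq> cylinder m n x" using U by (auto simp: sing cylinder_def)
  ultimately show ?thesis using that by blast
next
  case True
  define D where "D = (\<lambda>N. \<exists>y\<in>U. \<exists>z\<in>U. y N \<noteq> z N)"
  define N where "N = (LEAST N. D N)"
  have "\<exists>N. D N" using True by (auto simp: D_def)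
  then have DN: "D N" unfolding N_def by (rule LeastI_ex)
  have less: "\<not> D k" if "k < N" for k using that not_less_Least unfolding N_def by blast
  obtain y z where yz: "y \<in> U" "z \<in> U" "y N \<noteq> z N" using DN by (auto simp: D_def)
  have "y \<in> Sigma_seq m" "z \<in> Sigma_seq m" using yz(1,2) U(1) by auto
  then have "y 0 = z 0" by (simp add: Sigma_seq_def)
  then have "N \<noteq> 0" using yz(3) by metis
  then obtain n where n: "N = Suc n" by (cases N) auto
  have "(LEAST k. y k \<noteq> z k) = N"
  proof (rule Least_equality)
    show "N \<le> k" if "y k \<noteq> z k" for k using that less yz by (auto simp: D_def not_less[symmetric])
  qed (use yz in auto)
  then have "rho m y z = real m powr - real n" using yz by (auto simp: rho_def n)
  then have le: "real m powr - real n \<le> sdiam m U" using rho_le_sdiam[OF m U(1) yz(1,2)] by simp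
  with d have "real m powr - real n \<le> real m powr - real n0" by linarith
  then have "n0 \<le> n" using m by simp
  moreover have "U \<subseteq> cylinder m n x"
    using less U by (fastforce simp: cylinder_def D_def n)
  moreover have "real m powr (- s * real n) \<le> sdiam m U powr s + \<eta>"
  proof -
    have "real m powr (- s * real n) = (real m powr - real n) powr s" by (simp add: powr_powr mult.commute)
    also have "\<dots> \<le> sdiam m U powr s" using le s by (intro powr_mono2) auto
    finally show ?thesis using \<eta> by linarith
  qed
  ultimately show ?thesis by (rule that)
qed

text \<open>The convergence half of Borel-Cantelli for covers: each point of E lies in cylinders
  from \<open>G n\<close> for arbitrarily large n, and the costs of the levels from n0 on form the
  tail of a geometric series.\<close>

lemma hausdorff_measure_eq_0I:
  assumes m: "m \<ge> 2" and s: "s > 0" and r: "0 \<le> r" "r < 1"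
    and fin: "\<And>n. finite (G n)"
    and cover: "\<And>n0. E \<subseteq> (\<Union>n\<in>{n0..}. \<Union>u\<in>G n. cylinder m n u)"
    and sum: "\<And>n. real (card (G n)) * real m powr (- s * real n) \<le> r ^ n"
  shows "hausdorff_measure m s E = 0"
proof -
  have content: "hausdorff_content m s \<delta> E = 0" if \<delta>: "\<delta> > 0" for \<delta>
  proof -
    have small: "hausdorff_content m s \<delta> E \<le> ennreal (r ^ n0 / (1 - r))"
      if n0: "real m powr - real n0 \<le> \<delta>" for n0
    proof -
      obtain b where b: "\<And>n. bij_betw (b n) {..<card (G n)} (G n)"
        using ex_bij_betw_nat_finite[OF fin] by (metis atLeast0LessThan)
      define V where "V = (\<lambda>(n, j). if n \<ge> n0 \<and> j < card (G n) then cylinder m n (b n j) else {})"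
      have V1: "V nj \<subseteq> Sigma_seq m" for nj by (auto simp: V_def cylinder_def split: prod.splits)
      have dV: "sdiam m (V (n, j)) \<le> (if n \<ge> n0 \<and> j < card (G n) then real m powr - real n else 0)" for n j
      proof (cases "n \<ge> n0 \<and> j < card (G n)")
        case False
        then have "V (n, j) = {}" by (auto simp: V_def)
        then show ?thesis using False by (simp add: sdiam_def)
      qed (use sdiam_cylinder_le[OF m] in \<open>simp add: V_def\<close>)
      have V2: "sdiam m (V nj) \<le> \<delta>" for nj
      proof (cases nj)
        case (Pair n j)
        have "real m powr - real n \<le> real m powr - real n0" if "n \<ge> n0" using that m by simp
        then show ?thesis using dV[of n j] n0 \<delta> Pair by (auto split: if_splits)
      qed
      have V3: "E \<subseteq> (\<Union>i. V (prod_decode i))"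
      proof
        fix x assume "x \<in> E"
        then obtain n u where nu: "n \<ge> n0" "u \<in> G n" "x \<in> cylinder m n u" using cover[of n0] by auto
        then obtain j where "j < card (G n)" "u = b n j" using b[of n] by (auto simp: bij_betw_def)
        then have "x \<in> V (prod_decode (prod_encode (n, j)))" using nu by (simp add: V_def)
        then show "x \<in> (\<Union>i. V (prod_decode i))" by blast
      qed
      have "hausdorff_content m s \<delta> E \<le> (\<Sum>i. ennreal (sdiam m (V (prod_decode i)) powr s))"
        unfolding hausdorff_content_def using V1 V2 V3 by (intro INF_lower) auto
      also have "\<dots> = (\<Sum>n. \<Sum>j. ennreal (sdiam m (V (n, j)) powr s))"
        by (rule suminf_ennreal_2dimen) simp
      also have "\<dots> \<le> (\<Sum>n. ennreal (if n \<ge> n0 then r ^ n else 0))"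
      proof (intro suminf_le summableI)
        fix n
        have "(\<Sum>j. ennreal (sdiam m (V (n, j)) powr s)) = (\<Sum>j<card (G n). ennreal (sdiam m (V (n, j)) powr s))"
          using s by (intro suminf_finite) (auto simp: V_def sdiam_def)
        also have "\<dots> \<le> (\<Sum>j<card (G n). ennreal (if n \<ge> n0 then real m powr (- s * real n) else 0))"
        proof (intro sum_mono ennreal_leI)
          fix j assume "j \<in> {..<card (G n)}"
          then have "sdiam m (V (n, j)) powr s \<le> (if n \<ge> n0 then real m powr - real n else 0) powr s"
            using dV[of n j] s sdiam_nonneg[OF m V1] by (intro powr_mono2) auto
          then show "sdiam m (V (n, j)) powr s \<le> (if n \<ge> n0 then real m powr (- s * real n) else 0)"
            by (auto simp: powr_powr mult.commute split: if_splits)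
        qed
        also have "\<dots> = ennreal (real (card (G n)) * (if n \<ge> n0 then real m powr (- s * real n) else 0))"
          by (subst sum_ennreal) auto
        also have "\<dots> \<le> ennreal (if n \<ge> n0 then r ^ n else 0)"
          using sum[of n] by (intro ennreal_leI) auto
        finally show "(\<Sum>j. ennreal (sdiam m (V (n, j)) powr s)) \<le> ennreal (if n \<ge> n0 then r ^ n else 0)" .
      qed
      also have "\<dots> = ennreal (r ^ n0 / (1 - r))"
      proof (rule suminf_ennreal_eq)
        have "(\<lambda>n. r ^ n0 * r ^ n) sums (r ^ n0 * (1 / (1 - r)))"
          using r by (intro sums_mult geometric_sums) auto
        then have "(\<lambda>n. if n + n0 \<ge> n0 then r ^ (n + n0) else 0) sums (r ^ n0 / (1 - r))"
          by (simp add: power_add mult.commute)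
        then show "(\<lambda>n. if n \<ge> n0 then r ^ n else 0) sums (r ^ n0 / (1 - r))"
          by (subst (asm) sums_iff_shift) simp
      qed (use r in auto)
      finally show ?thesis .
    qed
    have "(\<lambda>n. real m powr - real n) \<longlonglongrightarrow> 0"
    proof -
      have "(\<lambda>n. (1 / real m) ^ n) \<longlonglongrightarrow> 0" using m by (intro LIMSEQ_power_zero) auto
      then show ?thesis using m by (simp add: powr_minus powr_realpow power_one_over inverse_eq_divide)
    qed
    then have ev: "\<forall>\<^sub>F n in sequentially. real m powr - real n < \<delta>" using \<delta> by (rule order_tendstoD)
    have lim: "(\<lambda>n. ennreal (r ^ n / (1 - r))) \<longlonglongrightarrow> ennreal 0"
      using r by (intro tendsto_ennrealI tendsto_eq_intros LIMSEQ_power_zero) auto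
    have "hausdorff_content m s \<delta> E \<le> ennreal 0"
      by (rule tendsto_lowerbound[OF lim]) (use ev small in \<open>auto elim!: eventually_mono\<close>)
    then show ?thesis by simp
  qed
  then show ?thesis unfolding hausdorff_measure_def by (auto intro!: SUP_eqI)
qed

subsection \<open>The multiplicative shift\<close>

locale mult_shift =
  fixes m q :: nat and a :: "nat \<Rightarrow> nat \<Rightarrow> real"
  assumes m2: "m \<ge> 2" and q2: "q \<ge> 2"
    and a01: "\<And>i j. i < m \<Longrightarrow> j < m \<Longrightarrow> a i j = 0 \<or> a i j = 1"
    and row: "\<And>i. i < m \<Longrightarrow> \<exists>j<m. a i j = 1"
begin

definition X :: "(nat \<Rightarrow> nat) set" where
  "X = {x \<in> Sigma_seq m. \<forall>k\<ge>1. a (x k) (x (q * k)) = 1}"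

definition allowed :: "nat \<Rightarrow> (nat \<Rightarrow> nat) \<Rightarrow> bool" where
  "allowed n u \<longleftrightarrow> (\<forall>k\<in>{1..n div q}. a (u k) (u (q * k)) = 1)"

lemma m_pos: "m > 0" and q_pos: "q \<ge> 1" and m_real: "real m > 1" and q_real: "real q > 1"
  using m2 q2 by auto

lemma X_less: "x \<in> X \<Longrightarrow> x k < m"
  using m2 by (cases "k = 0") (auto simp: X_def Sigma_seq_def)

lemma X_allowed: "x \<in> X \<Longrightarrow> allowed n x"
  by (auto simp: X_def allowed_def)

lemma X_truncate: "x \<in> X \<Longrightarrow> truncate n x \<in> words m n"
  by (rule truncate_word) (simp add: X_def)

lemma mult_le_of_le_div: "k \<le> n div q \<Longrightarrow> q * k \<le> n"
  using q_pos by (simp add: less_eq_div_iff_mult_less_eq mult.commute)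

lemma allowed_cong:
  assumes "\<And>k. k \<le> n \<Longrightarrow> u k = v k"
  shows "allowed n u \<longleftrightarrow> allowed n v"
proof -
  have "a (u k) (u (q * k)) = a (v k) (v (q * k))" if "k \<in> {1..n div q}" for k
  proof -
    have "k \<le> n div q" using that by simp
    then have "q * k \<le> n" "k \<le> n" using mult_le_of_le_div[of k n] div_le_dividend[of n q] by linarith+
    then show ?thesis by (simp add: assms)
  qed
  then show ?thesis by (auto simp: allowed_def)
qed

text \<open>The condition \<open>row\<close> makes every allowed word the beginning of a point of X;
  hence covering X means covering all allowed words.\<close>

lemma extend_word:
  assumes u: "u \<in> words m n" and al: "allowed n u"
  obtains x where "x \<in> X" "\<And>k. k \<le> n \<Longrightarrow> x k = u k"
proof -
  obtain succ where succ: "\<And>i. i < m \<Longrightarrow> succ i < m \<and> a i (succ i) = 1" using row by metis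
  \<comment> \<open>Beyond n a multiple of q receives a chosen successor of the letter at
    \<open>k div q\<close>, and any other index the letter 0. The recursion descends because
    \<open>k div q < k\<close>.\<close>
  define R where "R = (\<lambda>f k. if k \<le> n then u k else if q dvd k then succ (f (k div q)) else 0)"
  define x where "x = wfrec less_than R"
  have "adm_wf less_than R"
    unfolding adm_wf_def R_def using q2 by (auto simp: div_less_dividend)
  then have x_eq: "x k = R x k" for k
    unfolding x_def by (subst wfrec_fixpoint[OF wf_less_than]) auto
  have x_lt: "x k < m" for k
  proof (induction k rule: less_induct)
    case (less k)
    have "k div q < k" if "k > n" using that q2 by simp
    then show ?case using words_less[OF u m_pos] succ m_pos less[of "k div q"]
      by (subst x_eq) (auto simp: R_def)
  qed
  have x_u: "x k = u k" if "k \<le> n" for k using that by (subst x_eq) (simp add: R_def)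
  have "a (x k) (x (q * k)) = 1" if k: "k \<ge> 1" for k
  proof (cases "q * k \<le> n")
    case True
    moreover have "k \<le> q * k" using q2 by simp
    ultimately have "k \<le> n" by linarith
    have "k \<le> n div q" using True q_pos by (simp add: less_eq_div_iff_mult_less_eq mult.commute)
    then show ?thesis using al k True \<open>k \<le> n\<close> by (auto simp: x_u allowed_def)
  next
    case False
    then have "x (q * k) = succ (x k)" using q_pos by (subst x_eq) (simp add: R_def)
    then show ?thesis using succ[OF x_lt] by simp
  qed
  moreover have "x 0 = 0" using x_u[of 0] u by (simp add: words_def)
  ultimately have "x \<in> X" using x_lt by (auto simp: X_def Sigma_seq_def)
  then show ?thesis using that x_u by blast
qed

section \<open>Compactness in the product topology\<close>

lemma open_coordinate: "open {x :: nat \<Rightarrow> nat. P (x k) (x j)}"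
proof -
  have o: "open {x :: nat \<Rightarrow> nat. x k = c}" for k c
    using open_vimage[of "{c}" "\<lambda>x :: nat \<Rightarrow> nat. x k"] by (simp add: vimage_def open_discrete)
  have "{x :: nat \<Rightarrow> nat. P (x k) (x j)} = (\<Union>(c, d)\<in>{(c, d). P c d}. {x. x k = c} \<inter> {x. x j = d})" by auto
  moreover have "open \<dots>" by (intro open_UN ballI) (auto intro!: open_Int o)
  ultimately show ?thesis by simp
qed

lemma compact_X: "compact X"
proof -
  have "compactin (product_topology (\<lambda>_. euclidean) UNIV) (PiE UNIV (\<lambda>_ :: nat. {..<m}))"
    unfolding compactin_PiE by (auto simp: compactin_euclidean_iff intro!: finite_imp_compact)
  then have K: "compact (PiE UNIV (\<lambda>_ :: nat. {..<m}))"
    by (simp only: euclidean_product_topology compactin_euclidean_iff)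
  have "X = PiE UNIV (\<lambda>_. {..<m}) \<inter> ({x. x 0 = 0} \<inter> (\<Inter>k\<in>{1..}. {x. a (x k) (x (q * k)) = 1}))"
  proof (rule Set.set_eqI)
    fix x :: "nat \<Rightarrow> nat"
    have "(\<forall>k. x k < m) \<longleftrightarrow> (\<forall>k\<ge>1. x k < m)" if "x 0 = 0"
    proof (intro iffI allI)
      fix k assume "\<forall>k\<ge>1. x k < m"
      then show "x k < m" using that m_pos by (cases "k = 0") auto
    qed auto
    then show "x \<in> X \<longleftrightarrow>
        x \<in> PiE UNIV (\<lambda>_. {..<m}) \<inter> ({x. x 0 = 0} \<inter> (\<Inter>k\<in>{1..}. {x. a (x k) (x (q * k)) = 1}))"
      unfolding X_def Sigma_seq_def by (simp add: PiE_UNIV_domain Pi_def) blast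
  qed
  moreover have "closed ({x :: nat \<Rightarrow> nat. x 0 = 0} \<inter> (\<Inter>k\<in>{1..}. {x. a (x k) (x (q * k)) = 1}))"
    using open_coordinate[of "\<lambda>c d. c \<noteq> 0" 0 0] open_coordinate[of "\<lambda>c d. a c d \<noteq> 1"]
    by (intro closed_Int closed_INT ballI) (auto simp: closed_def Collect_neg_eq[symmetric])
  ultimately show ?thesis using compact_Int_closed[OF K] by simp
qed

text \<open>Within \<open>Sigma_seq m\<close> a cylinder is the trace of an open set of the product
  topology. Finitely many cylinders have a largest length, so a cover can be tested on words of that
  length.\<close>

lemma finite_cylinder_cover:
  assumes "X \<subseteq> (\<Union>i\<in>J. cylinder m (n i) (x i))"
  obtains I where "I \<subseteq> J" "finite I" "X \<subseteq> (\<Union>i\<in>I. cylinder m (n i) (x i))"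
proof -
  define V where "V = (\<lambda>i. {y :: nat \<Rightarrow> nat. \<forall>k\<in>{..n i}. y k = x i k})"
  have cyl: "cylinder m (n i) (x i) = Sigma_seq m \<inter> V i" for i by (auto simp: cylinder_def V_def)
  have o: "open (V i)" for i
    unfolding V_def using open_coordinate[of "\<lambda>c d. c = x i k" k k for k]
    by (subst Collect_ball_eq) (intro open_INT finite_atMost ballI)
  have sub: "X \<subseteq> (\<Union>i\<in>J. V i)" using assms unfolding cyl by blast
  obtain I where I: "I \<subseteq> J" "finite I" "X \<subseteq> (\<Union>i\<in>I. V i)"
    by (rule compactE_image[OF compact_X, of J V]) (use o sub in auto)
  have "X \<subseteq> Sigma_seq m" by (auto simp: X_def)
  with I(3) have "X \<subseteq> (\<Union>i\<in>I. cylinder m (n i) (x i))" unfolding cyl by blast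
  with I(1,2) show ?thesis by (rule that)
qed

end

subsection \<open>The optimal measure\<close>

locale mult_shift_solution = mult_shift +
  fixes t :: "nat \<Rightarrow> real"
  assumes t_gt_1: "\<And>i. i < m \<Longrightarrow> t i > 1"
    and t_eq: "\<And>i. i < m \<Longrightarrow> t i ^ q = (\<Sum>j<m. a i j * t j)"
begin

definition T :: real where "T = (\<Sum>i<m. t i)"

definition p :: "nat \<Rightarrow> nat \<Rightarrow> real" where "p i j = a i j * t j / t i ^ q"

definition p0 :: "nat \<Rightarrow> real" where "p0 j = t j / T"

definition ker :: "nat \<Rightarrow> nat \<Rightarrow> nat \<Rightarrow> real" where
  "ker k i j = (if q dvd k then p i j else p0 j)"

definition P :: "nat \<Rightarrow> (nat \<Rightarrow> nat) \<Rightarrow> real" where "P = weight q ker"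

definition S :: "nat \<Rightarrow> (nat \<Rightarrow> nat) \<Rightarrow> real" where "S n x = (\<Sum>k=1..n. ln (t (x k)))"

definition hdim :: real where "hdim = (real q - 1) / real q * log (real m) T"

lemma t_pos: "i < m \<Longrightarrow> t i > 0"
  using t_gt_1[of i] by simp

lemma t_le_T: "i < m \<Longrightarrow> t i \<le> T"
  unfolding T_def by (rule member_le_sum) (auto intro: less_imp_le t_pos)

lemma T_gt_1: "T > 1"
  using t_gt_1[OF m_pos] t_le_T[OF m_pos] by simp

lemma lnT_pos: "ln T > 0"
  using T_gt_1 by simp

lemma ln_t_bounds:
  assumes "i < m"
  shows "0 \<le> ln (t i)" "ln (t i) \<le> ln T"
  using t_gt_1[OF assms] t_le_T[OF assms] by auto

lemma hdim_ln: "hdim * ln (real m) = (1 - 1 / real q) * ln T"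
  using m_real q_real by (simp add: hdim_def log_def field_simps)

lemma hdim_pos: "hdim > 0"
  using m_real q_real T_gt_1 by (simp add: hdim_def)

lemma p_nonneg: "i < m \<Longrightarrow> j < m \<Longrightarrow> p i j \<ge> 0"
  using a01[of i j] t_pos[of i] t_pos[of j] by (auto simp: p_def)

lemma p0_nonneg: "j < m \<Longrightarrow> p0 j \<ge> 0"
  using T_gt_1 t_pos[of j] by (simp add: p0_def)

lemma ker_nonneg: "i < m \<Longrightarrow> j < m \<Longrightarrow> ker k i j \<ge> 0"
  by (simp add: ker_def p_nonneg p0_nonneg)

lemma sum_p: "i < m \<Longrightarrow> (\<Sum>j<m. p i j) = 1"
  using t_pos[of i] by (simp add: p_def t_eq[symmetric] flip: sum_divide_distrib)

lemma sum_p0: "(\<Sum>j<m. p0 j) = 1"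
  using T_gt_1 by (simp add: p0_def T_def flip: sum_divide_distrib)

lemma sum_ker: "i < m \<Longrightarrow> (\<Sum>j<m. ker k i j) = 1"
  by (cases "q dvd k") (simp_all add: ker_def sum_p sum_p0)

lemma P_nonneg: "(\<And>k. u k < m) \<Longrightarrow> P n u \<ge> 0"
  unfolding P_def weight_def by (intro prod_nonneg) (simp add: ker_nonneg)

lemma sum_P: "(\<Sum>u\<in>words m n. P n u) = 1"
  unfolding P_def by (rule sum_weight_eq_1) (auto simp: q2 m_pos sum_ker)

lemma sum_P_marginal:
  "l \<le> n \<Longrightarrow> (\<Sum>u\<in>words m n. F (truncate l u) * P n u) = (\<Sum>u\<in>words m l. F u * P l u)"
  unfolding P_def by (rule sum_weight_marginal) (auto simp: q2 m_pos sum_ker)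

lemma P_truncate: "P n (truncate n u) = P n u"
  unfolding P_def by (rule weight_truncate) simp

text \<open>The letter at k contributes \<open>ln (t (x k))\<close> through the numerator of its
  kernel. The denominators contribute \<open>- q * ln t\<close> at the parent for a multiple of q
  and \<open>- ln T\<close> for a root; regrouping by parents turns the former into a sum up to
  \<open>n div q\<close>.\<close>

lemma P_formula:
  assumes less: "\<And>k. x k < m" and al: "allowed n x"
  shows "P n x = exp (S n x - real q * S (n div q) x - real (card (chain_roots q n)) * ln T)"
proof -
  have "ker k (x (parent q k)) (x k) =
      exp (ln (t (x k)) + (if q dvd k then - real q * ln (t (x (k div q))) else - ln T))"
    if k: "k \<in> {1..n}" for k
  proof (cases "q dvd k")
    case True
    have "k div q \<in> {1..n div q}"
      using k True q2 by (auto simp: div_le_mono dvd_imp_le Suc_le_eq div_greater_zero_iff)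
    then have "a (x (k div q)) (x (q * (k div q))) = 1" using al unfolding allowed_def by blast
    then have "a (x (k div q)) (x k) = 1" using True by simp
    then have "ker k (x (parent q k)) (x k) = t (x k) / t (x (k div q)) ^ q"
      using True by (simp add: ker_def p_def parent_def)
    also have "\<dots> = exp (ln (t (x k)) - real q * ln (t (x (k div q))))"
      using t_pos[OF less] by (simp add: exp_diff exp_of_nat_mult)
    finally show ?thesis using True by simp
  next
    case False
    then have "ker k (x (parent q k)) (x k) = t (x k) / T" by (simp add: ker_def p0_def)
    also have "\<dots> = exp (ln (t (x k)) - ln T)" using t_pos[OF less] T_gt_1 by (simp add: exp_diff)
    finally show ?thesis using False by simp
  qed
  then have "P n x = (\<Prod>k=1..n. exp (ln (t (x k)) + (if q dvd k then - real q * ln (t (x (k div q))) else - ln T)))"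
    unfolding P_def weight_def by (intro prod.cong) auto
  also have "\<dots> = exp (S n x + (\<Sum>k=1..n. if q dvd k then - real q * ln (t (x (k div q))) else - ln T))"
    by (simp only: exp_sum[symmetric] finite_atLeastAtMost sum.distrib S_def)
  also have "(\<Sum>k=1..n. if q dvd k then - real q * ln (t (x (k div q))) else - ln T) =
      (\<Sum>k=1..n div q. - real q * ln (t (x k))) + (\<Sum>k\<in>chain_roots q n. - ln T)"
    by (rule sum.split_by_parent[OF q_pos])
  finally show ?thesis by (simp add: S_def sum_distrib_left sum_negf)
qed

lemma P_pos_imp_allowed:
  assumes "u \<in> words m n" "P n u \<noteq> 0"
  shows "allowed n u"
  unfolding allowed_def
proof
  fix k assume k: "k \<in> {1..n div q}"
  then have "q * k \<in> {1..n}" using mult_le_of_le_div[of k n] q_pos by simp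
  then have "ker (q * k) (u (parent q (q * k))) (u (q * k)) \<noteq> 0"
    using assms(2) unfolding P_def weight_def by (metis finite_atLeastAtMost prod_zero_iff)
  then have "a (u k) (u (q * k)) \<noteq> 0" using q_pos by (simp add: ker_def p_def parent_def)
  then show "a (u k) (u (q * k)) = 1" using a01[of "u k" "u (q * k)"] words_less[OF assms(1) m_pos] by blast
qed

lemma S_bounds:
  assumes "\<And>k. x k < m"
  shows "0 \<le> S n x" "S n x \<le> real n * ln T"
proof -
  show "0 \<le> S n x" unfolding S_def using assms by (intro sum_nonneg) (auto simp: ln_t_bounds)
  have "S n x \<le> (\<Sum>k=1..n. ln T)" unfolding S_def using assms by (intro sum_mono) (auto simp: ln_t_bounds)
  then show "S n x \<le> real n * ln T" by simp
qed

section \<open>Upper bound for the Hausdorff dimension\<close>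

text \<open>Along \<open>n = q ^ j\<close> the averages \<open>S n x / n\<close> are bounded, so infinitely often they drop by at most
  \<open>\<epsilon>\<close> from one step to the next.\<close>

lemma P_lower_infinitely_often:
  assumes x: "x \<in> X" and \<epsilon>: "\<epsilon> > 0"
  obtains n where "n \<ge> n0" "P n x \<ge> exp (- real n * (hdim * ln (real m) + \<epsilon>))"
proof -
  define A where "A = (\<lambda>j. S (q ^ j) x / real q ^ j)"
  have A: "0 \<le> A j" "A j \<le> ln T" for j
    using S_bounds[OF X_less[OF x], of "q ^ j"] q_pos by (auto simp: A_def divide_le_eq mult.commute)
  have "\<exists>j\<ge>n0. A (Suc j) - A j \<ge> - \<epsilon>"
  proof (rule ccontr)
    assume neg: "\<not> ?thesis"
    have dec: "A (n0 + i) \<le> A n0 - real i * \<epsilon>" for i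
    proof (induction i)
      case (Suc i)
      have "\<not> A (Suc (n0 + i)) - A (n0 + i) \<ge> - \<epsilon>" using neg by (metis le_add1)
      with Suc show ?case by (simp add: algebra_simps)
    qed simp
    obtain i :: nat where "ln T < real i * \<epsilon>" using reals_Archimedean3[OF \<epsilon>] by blast
    with dec[of i] A(1)[of "n0 + i"] A(2)[of n0] show False by linarith
  qed
  then obtain j where j: "j \<ge> n0" "A (Suc j) - A j \<ge> - \<epsilon>" by blast
  \<comment> \<open>At a power of q nothing is rounded: \<open>n div q = q ^ j\<close>, and the
    number of roots up to n is exactly \<open>n * (1 - 1 / q)\<close>.\<close>
  define n where "n = q ^ Suc j"
  have div: "n div q = q ^ j" using q_pos by (simp add: n_def)
  have "n0 \<le> n"
  proof -
    have "Suc j < q ^ Suc j" using q2 by (intro less_exp[THEN less_le_trans] power_mono) auto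
    then show ?thesis using j(1) unfolding n_def by linarith
  qed
  moreover have "P n x \<ge> exp (- real n * (hdim * ln (real m) + \<epsilon>))"
  proof -
    have qj: "real q ^ j > 0" using q_pos by simp
    have "real (card (chain_roots q n)) = real n * (1 - 1 / real q)"
    proof -
      have "q ^ j \<le> q ^ Suc j" using q_pos by simp
      then have "real (card (chain_roots q n)) = real (q ^ Suc j) - real (q ^ j)"
        by (simp only: card_chain_roots[OF q_pos] div of_nat_diff) (simp add: n_def)
      moreover have "real n * (1 - 1 / real q) = real (q ^ Suc j) - real (q ^ j)"
        using q_real by (simp add: n_def right_diff_distrib)
      ultimately show ?thesis by linarith
    qed
    moreover have "S n x - real q * S (n div q) x = real n * (A (Suc j) - A j)"
      using q_real unfolding div unfolding A_def n_def by (simp add: right_diff_distrib)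
    ultimately have "P n x = exp (real n * (A (Suc j) - A j) - real n * (1 - 1 / real q) * ln T)"
      by (simp only: P_formula[OF X_less[OF x] X_allowed[OF x]])
    moreover have "- real n * (hdim * ln (real m) + \<epsilon>) \<le> real n * (A (Suc j) - A j) - real n * (1 - 1 / real q) * ln T"
      using mult_left_mono[OF j(2), of "real n"] unfolding hdim_ln by (simp add: algebra_simps)
    ultimately show ?thesis by simp
  qed
  ultimately show ?thesis by (rule that)
qed

text \<open>The total mass is 1, so at most \<open>exp (n * c)\<close> words of length n have mass
  at least \<open>exp (- n * c)\<close>, and every point of X has such a beginning for arbitrarily
  large n.\<close>

lemma hausdorff_measure_above_hdim:
  assumes "s > hdim"
  shows "hausdorff_measure m s X = 0"
proof -
  define \<kappa> where "\<kappa> = (s - hdim) * ln (real m)"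
  have \<kappa>: "\<kappa> > 0" using assms m_real by (simp add: \<kappa>_def)
  \<comment> \<open>The midpoint of \<open>hdim * ln m\<close> and \<open>s * ln m\<close>; one half
    of \<kappa> pays for the infinitely-often lower bound, the other half gives the geometric
    decay.\<close>
  define c where "c = hdim * ln (real m) + \<kappa> / 2"
  define G where "G = (\<lambda>n. {u \<in> words m n. P n u \<ge> exp (- real n * c)})"
  show ?thesis
  proof (rule hausdorff_measure_eq_0I[where G = G and r = "exp (- \<kappa> / 2)"])
    show "m \<ge> 2" "s > 0" "exp (- \<kappa> / 2) \<ge> 0" "exp (- \<kappa> / 2) < 1" using m2 assms hdim_pos \<kappa> by auto
    show "finite (G n)" for n by (simp add: G_def)
    show "X \<subseteq> (\<Union>n\<in>{n0..}. \<Union>u\<in>G n. cylinder m n u)" for n0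
    proof
      fix x assume x: "x \<in> X"
      obtain n where n: "n \<ge> n0" "P n x \<ge> exp (- real n * c)"
        using P_lower_infinitely_often[OF x, of "\<kappa> / 2" n0] \<kappa> unfolding c_def by auto
      then have "truncate n x \<in> G n" using X_truncate[OF x] by (simp add: G_def P_truncate)
      moreover have "x \<in> cylinder m n (truncate n x)" using x by (auto simp: cylinder_def truncate_def X_def)
      ultimately show "x \<in> (\<Union>n\<in>{n0..}. \<Union>u\<in>G n. cylinder m n u)" using n(1) by blast
    qed
    show "real (card (G n)) * real m powr (- s * real n) \<le> exp (- \<kappa> / 2) ^ n" for n
    proof -
      have "real (card (G n)) * exp (- real n * c) = (\<Sum>u\<in>G n. exp (- real n * c))" by simp
      also have "\<dots> \<le> (\<Sum>u\<in>G n. P n u)" by (intro sum_mono) (simp add: G_def)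
      also have "\<dots> \<le> (\<Sum>u\<in>words m n. P n u)"
        using words_less[OF _ m_pos] by (intro sum_mono2 P_nonneg) (auto simp: G_def)
      finally have le: "real (card (G n)) * exp (- real n * c) \<le> 1" by (simp add: sum_P)
      have "real m powr (- s * real n) = exp (- real n * c) * exp (- \<kappa> / 2) ^ n"
        using m_pos by (simp add: powr_def c_def \<kappa>_def field_simps flip: exp_of_nat_mult exp_add)
      then have "real (card (G n)) * real m powr (- s * real n) =
          (real (card (G n)) * exp (- real n * c)) * exp (- \<kappa> / 2) ^ n" by simp
      also have "\<dots> \<le> 1 * exp (- \<kappa> / 2) ^ n" using le by (intro mult_right_mono) auto
      finally show ?thesis by simp
    qed
  qed
qed

subsection \<open>Concentration\<close>

text \<open>\<open>cond_exp l i\<close> is the expectation of \<open>ln t\<close> after \<open>l\<close> steps of the Markov chain \<open>p\<close> started at \<open>i\<close>,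
  and \<open>future N k i\<close> that of the sum of \<open>ln t\<close> over the part \<open>{k, q k, q\<^sup>2 k, \<dots>} \<inter> {..N}\<close> of a chain.\<close>

primrec cond_exp :: "nat \<Rightarrow> nat \<Rightarrow> real" where
  "cond_exp 0 = (\<lambda>i. ln (t i))"
| "cond_exp (Suc l) = (\<lambda>i. \<Sum>j<m. p i j * cond_exp l j)"

definition g :: "nat \<Rightarrow> real" where "g l = (\<Sum>j<m. p0 j * cond_exp l j)"

definition future :: "nat \<Rightarrow> nat \<Rightarrow> nat \<Rightarrow> real" where
  "future N k i = (\<Sum>l<chain_len q N k. cond_exp l i)"

lemma cond_exp_bounds:
  assumes "i < m"
  shows "0 \<le> cond_exp l i \<and> cond_exp l i \<le> ln T"
  using assms
proof (induction l arbitrary: i)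
  case (Suc l)
  have "(\<Sum>j<m. p i j * cond_exp l j) \<le> (\<Sum>j<m. p i j * ln T)"
    using Suc by (intro sum_mono mult_left_mono) (auto simp: p_nonneg)
  also have "\<dots> = ln T" using sum_p[OF Suc.prems] by (simp flip: sum_distrib_right)
  finally show ?case using Suc by (auto intro!: sum_nonneg mult_nonneg_nonneg p_nonneg)
qed (simp add: ln_t_bounds)

lemma g_bounds: "0 \<le> g l" "g l \<le> ln T"
proof -
  have "(\<Sum>j<m. p0 j * cond_exp l j) \<le> (\<Sum>j<m. p0 j * ln T)"
    by (intro sum_mono mult_left_mono) (auto simp: p0_nonneg cond_exp_bounds)
  then show "g l \<le> ln T" unfolding g_def using sum_p0 by (simp flip: sum_distrib_right)
  show "0 \<le> g l" unfolding g_def by (auto intro!: sum_nonneg mult_nonneg_nonneg p0_nonneg simp: cond_exp_bounds)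
qed

lemma abs_g_le: "\<bar>g l\<bar> \<le> ln T"
  using g_bounds[of l] by simp

lemma future_bound:
  assumes "i < m"
  shows "\<bar>future N k i\<bar> \<le> real (chain_len q N k) * ln T"
proof -
  have "\<bar>future N k i\<bar> \<le> (\<Sum>l<chain_len q N k. \<bar>cond_exp l i\<bar>)" unfolding future_def by (rule sum_abs)
  also have "\<dots> \<le> (\<Sum>l<chain_len q N k. ln T)"
    using cond_exp_bounds[OF assms] by (intro sum_mono) (simp add: abs_le_iff order_trans[of _ 0])
  finally show ?thesis by simp
qed

text \<open>The tower property: after the letter at k the chain continues at \<open>q * k\<close>
  with a letter drawn from \<open>p i\<close>.\<close>

lemma future_rec:
  assumes "k \<ge> 1"
  shows "future N k i = (if k \<le> N then ln (t i) else 0) + (\<Sum>j<m. p i j * future N (q * k) j)"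
proof (cases "k \<le> N")
  case True
  then have "future N k i = ln (t i) + (\<Sum>l<chain_len q N (q * k). \<Sum>j<m. p i j * cond_exp l j)"
    unfolding future_def chain_len_Suc[OF q2 assms True] by (simp add: sum.lessThan_Suc_shift del: sum.lessThan_Suc)
  also have "(\<Sum>l<chain_len q N (q * k). \<Sum>j<m. p i j * cond_exp l j) = (\<Sum>j<m. p i j * future N (q * k) j)"
    by (subst sum.swap) (simp add: future_def sum_distrib_left)
  finally show ?thesis using True by simp
next
  case False
  have "k \<le> q * k" using q2 by simp
  with False have "N < k" "N < q * k" by linarith+
  then show ?thesis using False q2 by (simp add: future_def chain_len_eq_0)
qed

lemma future_p0: "(\<Sum>j<m. p0 j * future N k j) = (\<Sum>l<chain_len q N k. g l)"
  unfolding g_def by (subst sum.swap) (simp add: future_def sum_distrib_left)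

text \<open>Each summand is the future sum at k minus its conditional expectation given the parent
  letter. Along a chain the expectation taken at k by \<open>future_rec\<close> cancels the one
  subtracted at \<open>q * k\<close>, which leaves S minus its mean. Summation may run beyond N so
  that the cases N = n and N = \<open>n div q\<close> can be combined index by index.\<close>

lemma martingale_decomposition:
  assumes "N \<le> n"
  shows "(\<Sum>k=1..n. future N k (u k) - (\<Sum>j<m. ker k (u (parent q k)) j * future N k j)) =
      S N u - chain_sum q g N"
proof -
  \<comment> \<open>This expectation occurs twice: in the recursion at k, and as the compensator of
    the index \<open>q * k\<close>.\<close>
  define h where "h = (\<lambda>k. \<Sum>j<m. p (u k) j * future N (q * k) j)"
  have "(\<Sum>k=1..n. future N k (u k)) = (\<Sum>k=1..n. if k \<le> N then ln (t (u k)) else 0) + (\<Sum>k=1..n. h k)"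
    unfolding sum.distrib[symmetric] h_def by (intro sum.cong future_rec) auto
  also have "(\<Sum>k=1..n. if k \<le> N then ln (t (u k)) else 0) = S N u"
    unfolding S_def using assms by (intro sum.mono_neutral_cong_right) auto
  also have "(\<Sum>k=1..n. h k) = (\<Sum>k=1..n div q. h k)"
  proof (rule sum.mono_neutral_right)
    show "\<forall>k\<in>{1..n} - {1..n div q}. h k = 0"
    proof
      fix k assume "k \<in> {1..n} - {1..n div q}"
      then have "\<not> k \<le> n div q" by auto
      then have "N < q * k"
        using assms q_pos less_eq_div_iff_mult_less_eq[of q k n] by (simp add: mult.commute)
      then show "h k = 0" using q2 by (simp add: h_def future_def chain_len_eq_0)
    qed
  qed auto
  finally have 1: "(\<Sum>k=1..n. future N k (u k)) = S N u + (\<Sum>k=1..n div q. h k)" .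
  have "(\<Sum>k=1..n. \<Sum>j<m. ker k (u (parent q k)) j * future N k j) =
      (\<Sum>k=1..n. if q dvd k then h (k div q) else (\<Sum>j<m. p0 j * future N k j))"
    by (intro sum.cong) (auto simp: ker_def parent_def h_def)
  also have "\<dots> = (\<Sum>k=1..n div q. h k) + (\<Sum>k\<in>chain_roots q n. \<Sum>j<m. p0 j * future N k j)"
    by (rule sum.split_by_parent[OF q_pos])
  also have "(\<Sum>k\<in>chain_roots q n. \<Sum>j<m. p0 j * future N k j) = chain_sum q g N"
    unfolding future_p0 chain_sum_def
  proof (rule sum.mono_neutral_right)
    show "\<forall>k\<in>chain_roots q n - chain_roots q N. (\<Sum>l<chain_len q N k. g l) = 0"
    proof
      fix k assume "k \<in> chain_roots q n - chain_roots q N"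
      then have "N < k" by (auto simp: chain_roots_def)
      then show "(\<Sum>l<chain_len q N k. g l) = 0" using q2 by (simp add: chain_len_eq_0)
    qed
  qed (use assms in \<open>auto simp: chain_roots_def\<close>)
  finally show ?thesis using 1 by (simp add: sum_subtractf)
qed

text \<open>24 = 4 * 6, with 4 from the square of 2R in \<open>exp_moment_le\<close> and 6 from
  \<open>sum_chain_len_square_le\<close>; \<open>(1 + q) * ln T\<close> bounds an increment of the
  correction per member of the chain.\<close>

definition conc_const :: real where "conc_const = 24 * ((1 + real q) * ln T)\<^sup>2"

lemma conc_const_pos: "conc_const > 0"
  using lnT_pos q_real by (simp add: conc_const_def zero_less_power)

lemma exp_moment_P:
  "(\<Sum>u\<in>words m n. P n u *
      exp (\<theta> * ((S n u - real q * S (n div q) u) - (chain_sum q g n - real q * chain_sum q g (n div q))))) \<le>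
    exp (\<theta>\<^sup>2 * conc_const * real n)"
proof -
  define F where "F = (\<lambda>k i. future n k i - real q * future (n div q) k i)"
  \<comment> \<open>The tilted kernel: the exponential of the martingale is a product over the same
    indices as P, so it is absorbed into the weights, and bounding the expectation reduces to
    bounding row sums one at a time.\<close>
  define w where "w = (\<lambda>k i j. ker k i j * exp (\<theta> * (F k j - (\<Sum>j<m. ker k i j * F k j))))"
  define R where "R = (\<lambda>k. (1 + real q) * ln T * real (chain_len q n k))"
  have dec: "(\<Sum>k=1..n. F k (u k) - (\<Sum>j<m. ker k (u (parent q k)) j * F k j)) =
      (S n u - real q * S (n div q) u) - (chain_sum q g n - real q * chain_sum q g (n div q))" for u
  proof -
    have "(\<Sum>k=1..n. F k (u k) - (\<Sum>j<m. ker k (u (parent q k)) j * F k j)) =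
      (\<Sum>k=1..n. future n k (u k) - (\<Sum>j<m. ker k (u (parent q k)) j * future n k j)) -
      real q * (\<Sum>k=1..n. future (n div q) k (u k) - (\<Sum>j<m. ker k (u (parent q k)) j * future (n div q) k j))"
      by (simp add: F_def right_diff_distrib sum_subtractf sum_distrib_left mult.left_commute)
    then show ?thesis
      unfolding martingale_decomposition[OF order_refl] martingale_decomposition[OF div_le_dividend]
      by (simp add: algebra_simps)
  qed
  have Pw: "P n u * exp (\<theta> * ((S n u - real q * S (n div q) u) -
      (chain_sum q g n - real q * chain_sum q g (n div q)))) = weight q w n u" for u
    unfolding dec[symmetric] P_def weight_def w_def prod.distrib sum_distrib_left by (simp add: exp_sum)
  have "(\<Sum>u\<in>words m n. weight q w n u) \<le> (\<Prod>k=1..n. exp (\<theta>\<^sup>2 * (2 * R k)\<^sup>2))"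
  proof (rule sum_weight_le)
    show "w k i j \<ge> 0" if "i < m" "j < m" for k i j using ker_nonneg[OF that] by (simp add: w_def)
    fix k i assume k: "1 \<le> k" "k \<le> n" and i: "i < m"
    show "(\<Sum>j<m. w k i j) \<le> exp (\<theta>\<^sup>2 * (2 * R k)\<^sup>2)"
      unfolding w_def
    proof (rule exp_moment_le)
      show "\<bar>F k j\<bar> \<le> R k" if "j \<in> {..<m}" for j
      proof -
        have j: "j < m" using that by simp
        have "chain_len q (n div q) k \<le> chain_len q n k"
        proof (rule ccontr)
          assume "\<not> ?thesis"
          then have "chain_len q n k < chain_len q (n div q) k" by simp
          then have "q ^ chain_len q n k * k \<le> n div q" by (simp only: less_chain_len_iff[OF q2 k(1)])
          then have "q ^ chain_len q n k * k \<le> n" using div_le_dividend[of n q] by linarith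
          then show False using less_chain_len_iff[OF q2 k(1)] by blast
        qed
        then have "real q * (real (chain_len q (n div q) k) * ln T) \<le> real q * (real (chain_len q n k) * ln T)"
          using lnT_pos by (intro mult_left_mono mult_right_mono) auto
        moreover have "\<bar>F k j\<bar> \<le> \<bar>future n k j\<bar> + real q * \<bar>future (n div q) k j\<bar>"
          unfolding F_def using abs_triangle_ineq4[of "future n k j" "real q * future (n div q) k j"]
          by (simp add: abs_mult)
        moreover have "real q * \<bar>future (n div q) k j\<bar> \<le> real q * (real (chain_len q (n div q) k) * ln T)"
          using future_bound[OF j] by (intro mult_left_mono) auto
        ultimately have "\<bar>F k j\<bar> \<le> real (chain_len q n k) * ln T + real q * (real (chain_len q n k) * ln T)"
          using future_bound[OF j, of n k] by linarith
        then show ?thesis by (simp add: R_def algebra_simps)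
      qed
    qed (use i in \<open>auto simp: ker_nonneg sum_ker\<close>)
  qed (use q2 m_pos in auto)
  also have "\<dots> = exp (\<theta>\<^sup>2 * 4 * ((1 + real q) * ln T)\<^sup>2 * (\<Sum>k=1..n. real (chain_len q n k) ^ 2))"
    by (simp add: exp_sum[symmetric] sum_distrib_left R_def power_mult_distrib mult.assoc)
  also have "\<dots> \<le> exp (\<theta>\<^sup>2 * conc_const * real n)"
    using mult_left_mono[OF sum_chain_len_square_le[OF q2, of n], of "\<theta>\<^sup>2 * 4 * ((1 + real q) * ln T)\<^sup>2"]
    by (simp add: conc_const_def mult.assoc mult.left_commute)
  finally show ?thesis by (simp only: Pw)
qed

text \<open>Both \<open>chain_sum q g n / n\<close> and the same quotient at \<open>n div q\<close>
  tend to one limit L, and \<open>q * (n div q) / n\<close> tends to 1, so the two means cancel to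
  first order.\<close>

lemma mean_limit:
  "(\<lambda>n. (chain_sum q g n - real q * chain_sum q g (n div q)) / real n) \<longlonglongrightarrow> 0"
proof -
  define L where "L = (1 - 1 / real q) * (\<Sum>l. g l / real q ^ l)"
  have lim: "(\<lambda>n. chain_sum q g n / real n) \<longlonglongrightarrow> L"
    unfolding L_def by (rule chain_sum_limit[OF q2 abs_g_le])
  have "filterlim (\<lambda>n. n div q) sequentially sequentially"
  proof (rule filterlim_at_top[THEN iffD2], rule allI)
    fix Z :: nat
    show "\<forall>\<^sub>F n in sequentially. Z \<le> n div q"
      using q_pos by (intro eventually_sequentiallyI[of "Z * q"]) (simp add: less_eq_div_iff_mult_less_eq)
  qed
  then have lim2: "(\<lambda>n. chain_sum q g (n div q) / real (n div q)) \<longlonglongrightarrow> L"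
    by (rule filterlim_compose[OF lim])
  have lim3: "(\<lambda>n. real (n div q) / real n) \<longlonglongrightarrow> 1 / real q"
  proof (rule tendsto_sandwich)
    show "\<forall>\<^sub>F n in sequentially. 1 / real q - 1 / real n \<le> real (n div q) / real n"
    proof (rule eventually_sequentiallyI[of 1])
      fix n :: nat assume n: "1 \<le> n"
      have "n < (n div q + 1) * q"
        using mod_less_divisor[of q n] q_pos div_mult_mod_eq[of n q] unfolding distrib_right by linarith
      then have "real n < (real (n div q) + 1) * real q"
        by (metis of_nat_less_iff of_nat_mult of_nat_add of_nat_1)
      then have "real n / real q \<le> real (n div q) + 1" using q_real by (simp add: divide_le_eq)
      then have "(real n / real q) / real n \<le> (real (n div q) + 1) / real n" by (rule divide_right_mono) simp
      then show "1 / real q - 1 / real n \<le> real (n div q) / real n"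
        using n by (simp add: add_divide_distrib)
    qed
    show "\<forall>\<^sub>F n in sequentially. real (n div q) / real n \<le> 1 / real q"
    proof (rule eventually_sequentiallyI[of 1])
      fix n :: nat assume n: "1 \<le> n"
      have "real (n div q) / real n \<le> (real n / real q) / real n"
        by (intro divide_right_mono of_nat_div_le_of_nat) simp
      then show "real (n div q) / real n \<le> 1 / real q" using n by simp
    qed
    show "(\<lambda>n. 1 / real q - 1 / real n) \<longlonglongrightarrow> 1 / real q"
      using tendsto_diff[OF tendsto_const lim_1_over_n, of "1 / real q"] by simp
  qed simp
  have "(\<lambda>n. chain_sum q g n / real n - real q * ((chain_sum q g (n div q) / real (n div q)) * (real (n div q) / real n)))
      \<longlonglongrightarrow> L - real q * (L * (1 / real q))"
    by (rule tendsto_diff[OF lim tendsto_mult[OF tendsto_const tendsto_mult[OF lim2 lim3]]])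
  \<comment> \<open>For n < q the middle quotient divides by 0, but the chain sum at 0 is empty, so
    the identity persists.\<close>
  moreover have "chain_sum q g n / real n - real q * ((chain_sum q g (n div q) / real (n div q)) * (real (n div q) / real n))
      = (chain_sum q g n - real q * chain_sum q g (n div q)) / real n" for n
  proof (cases "n div q = 0")
    case True
    then have "chain_sum q g (n div q) = 0" by (simp add: chain_sum_def chain_roots_def)
    then show ?thesis using True by simp
  qed (simp add: diff_divide_distrib)
  ultimately show ?thesis using q_real by simp
qed

section \<open>Lower bound for the Hausdorff dimension\<close>

text \<open>The words that violate the bound required by the mass distribution principle at exponent
  s.\<close>

definition bad :: "real \<Rightarrow> nat \<Rightarrow> (nat \<Rightarrow> nat) set" where
  "bad s n = {u \<in> words m n. P n u > real m powr (- s * real n)}"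

text \<open>By \<open>P_formula\<close> a bad word has correction at least
  \<open>\<kappa> * n\<close>. Its mean is eventually below half of that, so the centred correction
  exceeds \<open>\<kappa> / 2 * n\<close>, and the exponential Markov inequality applies.\<close>

lemma bad_exponentially_small:
  assumes "s < hdim"
  obtains c n1 where "c > 0" "\<And>n. n \<ge> n1 \<Longrightarrow> (\<Sum>u\<in>bad s n. P n u) \<le> exp (- c) ^ n"
proof -
  define \<kappa> where "\<kappa> = (hdim - s) * ln (real m)"
  have \<kappa>: "\<kappa> > 0" using assms m_real by (simp add: \<kappa>_def)
  \<comment> \<open>This \<theta> minimises
    \<open>- \<theta> * \<kappa> / 2 + \<theta>\<^sup>2 * conc_const\<close>, and the minimum is
    -c.\<close>
  define \<theta> where "\<theta> = \<kappa> / (4 * conc_const)"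
  define c where "c = \<kappa>\<^sup>2 / (16 * conc_const)"
  have \<theta>: "\<theta> > 0" and c: "c > 0" using \<kappa> conc_const_pos by (auto simp: \<theta>_def c_def)
  have "\<forall>\<^sub>F n in sequentially. (chain_sum q g n - real q * chain_sum q g (n div q)) / real n < \<kappa> / 2"
    using mean_limit \<kappa> by (intro order_tendstoD(2)) auto
  then obtain n1 where n1: "\<And>n. n \<ge> n1 \<Longrightarrow>
      (chain_sum q g n - real q * chain_sum q g (n div q)) / real n < \<kappa> / 2"
    unfolding eventually_sequentially by blast
  have "(\<Sum>u\<in>bad s n. P n u) \<le> exp (- c) ^ n" if n: "n \<ge> max n1 1" for n
  proof -
    define Y where "Y = (\<lambda>u. (S n u - real q * S (n div q) u) -
        (chain_sum q g n - real q * chain_sum q g (n div q)))"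
    have npos: "real n > 0" using n by simp
    have nonneg: "P n u \<ge> 0" if "u \<in> words m n" for u using that words_less[OF that m_pos] by (intro P_nonneg)
    have Y: "Y u \<ge> \<kappa> / 2 * real n" if u: "u \<in> bad s n" for u
    proof -
      have uw: "u \<in> words m n" and big: "P n u > real m powr (- s * real n)" using u by (auto simp: bad_def)
      have "P n u \<noteq> 0" using big powr_ge_zero[of "real m" "- s * real n"] by linarith
      then have "allowed n u" by (rule P_pos_imp_allowed[OF uw])
      then have "exp (- s * real n * ln (real m)) <
          exp (S n u - real q * S (n div q) u - real (card (chain_roots q n)) * ln T)"
        using big P_formula[OF words_less[OF uw m_pos]] m_pos by (simp add: powr_def)
      then have 1: "- s * real n * ln (real m) <
          S n u - real q * S (n div q) u - real (card (chain_roots q n)) * ln T" by simp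
      \<comment> \<open>Rounding \<open>n / q\<close> down only increases the number of roots, which
        is the favourable direction here.\<close>
      have "real (card (chain_roots q n)) = real n - real (n div q)"
        by (simp add: card_chain_roots[OF q_pos] of_nat_diff)
      then have "real (card (chain_roots q n)) \<ge> real n * (1 - 1 / real q)"
        using of_nat_div_le_of_nat[of n q, where 'a = real] by (simp add: right_diff_distrib)
      then have "real (card (chain_roots q n)) * ln T \<ge> real n * (1 - 1 / real q) * ln T"
        using lnT_pos by (intro mult_right_mono) auto
      moreover have "real n * (1 - 1 / real q) * ln T = real n * (hdim * ln (real m))"
        by (simp only: hdim_ln mult.assoc)
      ultimately have "real n * \<kappa> \<le> S n u - real q * S (n div q) u"
        using 1 by (simp add: \<kappa>_def algebra_simps)
      moreover have "chain_sum q g n - real q * chain_sum q g (n div q) < \<kappa> / 2 * real n"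
        using n1[of n] n npos by (simp add: divide_less_eq)
      ultimately show ?thesis by (simp add: Y_def algebra_simps)
    qed
    have "(\<Sum>u\<in>bad s n. P n u) \<le> (\<Sum>u\<in>bad s n. P n u * exp (\<theta> * (Y u - \<kappa> / 2 * real n)))"
    proof (rule sum_mono)
      fix u assume u: "u \<in> bad s n"
      have "1 \<le> exp (\<theta> * (Y u - \<kappa> / 2 * real n))" using Y[OF u] \<theta> by simp
      moreover have "P n u \<ge> 0" using u by (intro nonneg) (simp add: bad_def)
      ultimately show "P n u \<le> P n u * exp (\<theta> * (Y u - \<kappa> / 2 * real n))" by (simp add: mult_le_cancel_left1)
    qed
    also have "\<dots> \<le> (\<Sum>u\<in>words m n. P n u * exp (\<theta> * (Y u - \<kappa> / 2 * real n)))"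
      by (intro sum_mono2) (auto simp: bad_def intro!: mult_nonneg_nonneg nonneg)
    also have "\<dots> = exp (- \<theta> * \<kappa> / 2 * real n) * (\<Sum>u\<in>words m n. P n u * exp (\<theta> * Y u))"
      unfolding sum_distrib_left
    proof (rule sum.cong)
      fix u
      have "exp (\<theta> * (Y u - \<kappa> / 2 * real n)) = exp (- \<theta> * \<kappa> / 2 * real n) * exp (\<theta> * Y u)"
        by (simp add: algebra_simps flip: exp_add)
      then show "P n u * exp (\<theta> * (Y u - \<kappa> / 2 * real n)) = exp (- \<theta> * \<kappa> / 2 * real n) * (P n u * exp (\<theta> * Y u))"
        by simp
    qed simp
    also have "\<dots> \<le> exp (- \<theta> * \<kappa> / 2 * real n) * exp (\<theta>\<^sup>2 * conc_const * real n)"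
      using exp_moment_P[of n \<theta>] by (intro mult_left_mono) (simp_all add: Y_def)
    also have "\<dots> = exp (real n * (- \<theta> * \<kappa> / 2 + \<theta>\<^sup>2 * conc_const))"
      by (simp add: algebra_simps flip: exp_add)
    also have "- \<theta> * \<kappa> / 2 + \<theta>\<^sup>2 * conc_const = - c"
      using conc_const_pos by (simp add: \<theta>_def c_def power2_eq_square field_simps)
    finally show ?thesis by (simp flip: exp_of_nat_mult)
  qed
  then show ?thesis using that[OF c] by blast
qed

text \<open>The mass distribution principle at one finite level. A word of length N with positive
  mass extends to a point of X and so lies in some cylinder i; its beginning of length
  \<open>n i\<close> is either bad or has mass at most the cost of that cylinder. Consistency moves
  each contribution to its own length.\<close>

lemma cylinder_cover_sum_ge:
  assumes I: "finite I" and cover: "X \<subseteq> (\<Union>i\<in>I. cylinder m (n i) (x i))"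
    and x: "\<And>i. i \<in> I \<Longrightarrow> x i \<in> Sigma_seq m" and n0: "\<And>i. i \<in> I \<Longrightarrow> n i \<ge> n0"
    and N: "\<And>i. i \<in> I \<Longrightarrow> n i \<le> N"
  shows "1 \<le> (\<Sum>i\<in>I. real m powr (- s * real (n i))) + (\<Sum>k=n0..N. \<Sum>u\<in>bad s k. P k u)"
proof -
  \<comment> \<open>Both indicators are functions of a truncation, as the marginal formula
    requires.\<close>
  define F where "F = (\<lambda>i v. of_bool (v = truncate (n i) (x i) \<and> v \<notin> bad s (n i)) :: real)"
  define B where "B = (\<lambda>k v. of_bool (v \<in> bad s k) :: real)"
  have "P N u \<le> (\<Sum>i\<in>I. F i (truncate (n i) u) * P N u) + (\<Sum>k=n0..N. B k (truncate k u) * P N u)"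
    if u: "u \<in> words m N" for u
  proof (cases "P N u = 0")
    case False
    have nonneg: "P N u \<ge> 0" using words_less[OF u m_pos] by (rule P_nonneg)
    obtain y where y: "y \<in> X" "\<And>k. k \<le> N \<Longrightarrow> y k = u k"
      using extend_word[OF u P_pos_imp_allowed[OF u False]] by blast
    then obtain i where i: "i \<in> I" "y \<in> cylinder m (n i) (x i)" using cover by blast
    have tr: "truncate (n i) u = truncate (n i) (x i)"
    proof
      fix k
      show "truncate (n i) u k = truncate (n i) (x i) k"
        using i(2) y(2)[of k] N[OF i(1)] by (auto simp: truncate_def cylinder_def)
    qed
    show ?thesis
    proof (cases "truncate (n i) u \<in> bad s (n i)")
      case True
      have "P N u = B (n i) (truncate (n i) u) * P N u" using True by (simp add: B_def)
      also have "\<dots> \<le> (\<Sum>k=n0..N. B k (truncate k u) * P N u)"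
        using n0[OF i(1)] N[OF i(1)] nonneg
        by (intro member_le_sum[of _ _ "\<lambda>k. B k (truncate k u) * P N u"]) (auto simp: B_def)
      moreover have "0 \<le> (\<Sum>i\<in>I. F i (truncate (n i) u) * P N u)"
        using nonneg by (intro sum_nonneg) (simp add: F_def)
      ultimately show ?thesis by linarith
    next
      case False
      have "P N u = F i (truncate (n i) u) * P N u" using False tr by (simp add: F_def)
      also have "\<dots> \<le> (\<Sum>i\<in>I. F i (truncate (n i) u) * P N u)"
        using nonneg I i(1) by (intro member_le_sum[of _ _ "\<lambda>i. F i (truncate (n i) u) * P N u"]) (auto simp: F_def)
      moreover have "0 \<le> (\<Sum>k=n0..N. B k (truncate k u) * P N u)"
        using nonneg by (intro sum_nonneg) (simp add: B_def)
      ultimately show ?thesis by linarith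
    qed
  qed simp
  then have "(\<Sum>u\<in>words m N. P N u) \<le>
      (\<Sum>u\<in>words m N. (\<Sum>i\<in>I. F i (truncate (n i) u) * P N u) + (\<Sum>k=n0..N. B k (truncate k u) * P N u))"
    by (rule sum_mono)
  also have "\<dots> = (\<Sum>i\<in>I. \<Sum>u\<in>words m N. F i (truncate (n i) u) * P N u) +
      (\<Sum>k=n0..N. \<Sum>u\<in>words m N. B k (truncate k u) * P N u)"
    unfolding sum.distrib by (intro arg_cong2[where f = "(+)"] sum.swap)
  also have "(\<Sum>k=n0..N. \<Sum>u\<in>words m N. B k (truncate k u) * P N u) = (\<Sum>k=n0..N. \<Sum>u\<in>bad s k. P k u)"
  proof (rule sum.cong)
    fix k assume "k \<in> {n0..N}"
    then have "(\<Sum>u\<in>words m N. B k (truncate k u) * P N u) = (\<Sum>u\<in>words m k. B k u * P k u)"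
      by (intro sum_P_marginal) simp
    also have "\<dots> = (\<Sum>u\<in>bad s k. P k u)"
      by (intro sum.mono_neutral_cong_right) (auto simp: B_def bad_def)
    finally show "(\<Sum>u\<in>words m N. B k (truncate k u) * P N u) = (\<Sum>u\<in>bad s k. P k u)" .
  qed simp
  also have "(\<Sum>i\<in>I. \<Sum>u\<in>words m N. F i (truncate (n i) u) * P N u) \<le> (\<Sum>i\<in>I. real m powr (- s * real (n i)))"
  proof (rule sum_mono)
    fix i assume i: "i \<in> I"
    define v where "v = truncate (n i) (x i)"
    have v: "v \<in> words m (n i)" unfolding v_def using x[OF i] by (rule truncate_word)
    have "(\<Sum>u\<in>words m N. F i (truncate (n i) u) * P N u) = (\<Sum>u\<in>words m (n i). F i u * P (n i) u)"
      using N[OF i] by (rule sum_P_marginal)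
    also have "\<dots> = (\<Sum>u\<in>{v}. F i u * P (n i) u)"
      using v by (intro sum.mono_neutral_right) (auto simp: F_def v_def)
    also have "\<dots> = F i v * P (n i) v" by simp
    also have "\<dots> \<le> real m powr (- s * real (n i))"
      using v by (cases "v \<in> bad s (n i)") (auto simp: F_def bad_def not_less)
    finally show "(\<Sum>u\<in>words m N. F i (truncate (n i) u) * P N u) \<le> real m powr (- s * real (n i))" .
  qed
  finally show ?thesis by (simp add: sum_P)
qed

text \<open>The mass 1 is budgeted: 1/4 for all bad words of length at least n0, 1/4 for the slack
  in replacing sets by cylinders, so any fine cover costs at least 1/2.\<close>

lemma hausdorff_measure_below_hdim:
  assumes "s > 0" "s < hdim"
  shows "hausdorff_measure m s X \<noteq> 0"
proof -
  obtain c n1 where c: "c > 0" and n1: "\<And>n. n \<ge> n1 \<Longrightarrow> (\<Sum>u\<in>bad s n. P n u) \<le> exp (- c) ^ n"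
    using bad_exponentially_small[OF assms(2)] by blast
  define r where "r = exp (- c)"
  have r: "0 < r" "r < 1" using c by (auto simp: r_def)
  have "(\<lambda>n. r ^ n / (1 - r)) \<longlonglongrightarrow> 0 / (1 - r)" using r by (intro tendsto_divide LIMSEQ_power_zero) auto
  then have "\<forall>\<^sub>F n in sequentially. r ^ n / (1 - r) < 1 / 4"
    by (intro order_tendstoD(2)) auto
  with eventually_ge_at_top[of n1] have "\<forall>\<^sub>F n in sequentially. n1 \<le> n \<and> r ^ n / (1 - r) < 1 / 4"
    by (rule eventually_conj)
  then obtain n0 where n0: "n1 \<le> n0" "r ^ n0 / (1 - r) < 1 / 4" unfolding eventually_sequentially by blast
  have bad_sum: "(\<Sum>k=n0..N. \<Sum>u\<in>bad s k. P k u) \<le> 1 / 4" for N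
  proof -
    have "(\<Sum>k=n0..N. \<Sum>u\<in>bad s k. P k u) \<le> (\<Sum>k=n0..N. r ^ k)"
      unfolding r_def using n0 by (intro sum_mono n1) simp
    also have "\<dots> \<le> r ^ n0 / (1 - r)"
    proof (cases "n0 \<le> N")
      case True
      then have "(\<Sum>k=n0..N. r ^ k) = (r ^ n0 - r ^ Suc N) / (1 - r)"
        using sum_gp[of r n0 N] r by simp
      also have "\<dots> \<le> r ^ n0 / (1 - r)" using r by (intro divide_right_mono) auto
      finally show ?thesis .
    qed (use r in auto)
    finally show ?thesis using n0 by linarith
  qed
  have ge: "ennreal (1 / 2) \<le> (\<Sum>i. ennreal (sdiam m (U i) powr s))"
    if U: "\<And>i. U i \<subseteq> Sigma_seq m" "\<And>i. sdiam m (U i) \<le> real m powr - real n0" "X \<subseteq> (\<Union>i. U i)"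
    for U :: "nat \<Rightarrow> (nat \<Rightarrow> nat) set"
  proof -
    define J where "J = {i. U i \<noteq> {}}"
    \<comment> \<open>Positive slacks with total 1/4 over all i, independent of which finite
      subcover is chosen later.\<close>
    define \<eta> where "\<eta> = (\<lambda>i :: nat. (1 / 4) * (1 / 2 :: real) ^ Suc i)"
    have "\<exists>n x. n0 \<le> n \<and> x \<in> U i \<and> U i \<subseteq> cylinder m n x \<and> real m powr (- s * real n) \<le> sdiam m (U i) powr s + \<eta> i"
      if "i \<in> J" for i
    proof -
      obtain x where x: "x \<in> U i" using \<open>i \<in> J\<close> by (auto simp: J_def)
      have "\<eta> i > 0" by (simp add: \<eta>_def)
      from small_set_in_cylinder[OF m2 U(1) x U(2) assms(1) this] x show ?thesis by metis
    qed
    then obtain n x where nx: "\<And>i. i \<in> J \<Longrightarrow> n0 \<le> n i \<and> x i \<in> U i \<and> U i \<subseteq> cylinder m (n i) (x i) \<and>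
        real m powr (- s * real (n i)) \<le> sdiam m (U i) powr s + \<eta> i" by metis
    have "X \<subseteq> (\<Union>i\<in>J. cylinder m (n i) (x i))"
    proof
      fix y assume "y \<in> X"
      then obtain i where "y \<in> U i" using U(3) by blast
      then have "i \<in> J" by (auto simp: J_def)
      then show "y \<in> (\<Union>i\<in>J. cylinder m (n i) (x i))" using nx[of i] \<open>y \<in> U i\<close> by blast
    qed
    then obtain I where I: "I \<subseteq> J" "finite I" "X \<subseteq> (\<Union>i\<in>I. cylinder m (n i) (x i))"
      by (rule finite_cylinder_cover)
    obtain N where N: "\<And>i. i \<in> I \<Longrightarrow> n i \<le> N"
      using I(2) finite_nat_set_iff_bounded_le[of "n ` I"] by auto
    have "1 \<le> (\<Sum>i\<in>I. real m powr (- s * real (n i))) + (\<Sum>k=n0..N. \<Sum>u\<in>bad s k. P k u)"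
      using I nx N U(1) by (intro cylinder_cover_sum_ge[where x = x]) blast+
    then have "3 / 4 \<le> (\<Sum>i\<in>I. real m powr (- s * real (n i)))" using bad_sum[of N] by linarith
    also have "\<dots> \<le> (\<Sum>i\<in>I. sdiam m (U i) powr s + \<eta> i)" using I(1) nx by (intro sum_mono) blast
    also have "\<dots> = (\<Sum>i\<in>I. sdiam m (U i) powr s) + (\<Sum>i\<in>I. \<eta> i)" by (rule sum.distrib)
    also have "(\<Sum>i\<in>I. \<eta> i) \<le> 1 / 4"
    proof -
      have s1: "\<eta> sums (1 / 4 * 1)" unfolding \<eta>_def by (intro sums_mult power_half_series)
      have "(\<Sum>i\<in>I. \<eta> i) \<le> suminf \<eta>"
        using s1 I(2) by (intro sum_le_suminf) (auto simp: \<eta>_def sums_iff)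
      then show ?thesis using s1 by (simp add: sums_iff)
    qed
    finally have "1 / 2 \<le> (\<Sum>i\<in>I. sdiam m (U i) powr s)" by linarith
    then have "ennreal (1 / 2) \<le> ennreal (\<Sum>i\<in>I. sdiam m (U i) powr s)" by (rule ennreal_leI)
    also have "\<dots> = (\<Sum>i\<in>I. ennreal (sdiam m (U i) powr s))" by (rule sum_ennreal[symmetric]) simp
    also have "\<dots> \<le> (\<Sum>i. ennreal (sdiam m (U i) powr s))" by (rule sum_le_suminf) (use I in auto)
    finally show ?thesis .
  qed
  have "ennreal (1 / 2) \<le> hausdorff_content m s (real m powr - real n0) X"
    unfolding hausdorff_content_def by (intro INF_greatest ge) auto
  also have "\<dots> \<le> hausdorff_measure m s X"
    unfolding hausdorff_measure_def using m_pos by (intro SUP_upper) simp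
  finally show ?thesis by (auto simp: ennreal_eq_0_iff)
qed

theorem hausdorff_dim_X: "hausdorff_dim m X = hdim"
  unfolding hausdorff_dim_def
proof (rule antisym)
  have bdd: "bdd_below {s. 0 < s \<and> hausdorff_measure m s X = 0}" by (auto intro!: bdd_belowI[of _ 0])
  show "Inf {s. 0 < s \<and> hausdorff_measure m s X = 0} \<le> hdim"
  proof (rule field_le_epsilon)
    fix e :: real assume "e > 0"
    then have "hdim + e \<in> {s. 0 < s \<and> hausdorff_measure m s X = 0}"
      using hausdorff_measure_above_hdim hdim_pos by simp
    then show "Inf {s. 0 < s \<and> hausdorff_measure m s X = 0} \<le> hdim + e" using bdd by (rule cInf_lower)
  qed
  show "hdim \<le> Inf {s. 0 < s \<and> hausdorff_measure m s X = 0}"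
  proof (rule cInf_greatest)
    have "hdim + 1 \<in> {s. 0 < s \<and> hausdorff_measure m s X = 0}"
      using hausdorff_measure_above_hdim hdim_pos by simp
    then show "{s. 0 < s \<and> hausdorff_measure m s X = 0} \<noteq> {}" by blast
    show "hdim \<le> s" if "s \<in> {s. 0 < s \<and> hausdorff_measure m s X = 0}" for s
      using that hausdorff_measure_below_hdim[of s] by (auto simp: not_less[symmetric])
  qed
qed

end

subsection \<open>Counting allowed words\<close>

context mult_shift
begin

text \<open>Entry i of the k-th power of the matrix applied to the all-ones vector. It counts walks
  of k steps, hence k + 1 letters, which explains the shifts by one below.\<close>

primrec walks :: "nat \<Rightarrow> nat \<Rightarrow> real" where
  "walks 0 = (\<lambda>i. 1)"
| "walks (Suc k) = (\<lambda>i. \<Sum>j<m. a i j * walks k j)"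

definition walks_total :: "nat \<Rightarrow> real" where "walks_total k = (\<Sum>i<m. walks k i)"

text \<open>Indexed by the number of letters, unlike \<open>walks_total\<close>; the value 0 at 0
  lets increments telescope from the empty chain.\<close>

definition ln_walks :: "nat \<Rightarrow> real" where
  "ln_walks k = (case k of 0 \<Rightarrow> 0 | Suc k \<Rightarrow> ln (walks_total k))"

definition num_words :: "nat \<Rightarrow> nat" where "num_words n = card {u \<in> words m n. allowed n u}"

lemma a_nonneg: "i < m \<Longrightarrow> j < m \<Longrightarrow> a i j \<ge> 0" and a_le_1: "i < m \<Longrightarrow> j < m \<Longrightarrow> a i j \<le> 1"
  using a01[of i j] by auto

lemma walks_ge_1: "i < m \<Longrightarrow> walks k i \<ge> 1"
proof (induction k arbitrary: i)
  case (Suc k)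
  obtain j where j: "j < m" "a i j = 1" using row[OF Suc.prems] by blast
  have "1 \<le> a i j * walks k j" using Suc.IH[OF j(1)] j by simp
  also have "\<dots> \<le> (\<Sum>j<m. a i j * walks k j)"
  proof (rule member_le_sum)
    show "0 \<le> a i l * walks k l" if "l \<in> {..<m} - {j}" for l
      using that a_nonneg[OF Suc.prems, of l] Suc.IH[of l] by simp
  qed (use j in auto)
  finally show ?case by simp
qed simp

lemma walks_mono: "i < m \<Longrightarrow> walks k i \<le> walks (Suc k) i"
proof (induction k arbitrary: i)
  case 0
  then show ?case using walks_ge_1[of i "Suc 0"] by simp
next
  case (Suc k)
  have "(\<Sum>j<m. a i j * walks k j) \<le> (\<Sum>j<m. a i j * walks (Suc k) j)"
    using Suc by (intro sum_mono mult_left_mono) (auto simp: a_nonneg simp del: walks.simps)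
  then show ?case by simp
qed

lemma walks_total_ge: "walks_total k \<ge> real m"
proof -
  have "(\<Sum>i<m. 1) \<le> walks_total k" unfolding walks_total_def by (intro sum_mono) (simp add: walks_ge_1)
  then show ?thesis by simp
qed

lemma walks_total_Suc: "walks_total k \<le> walks_total (Suc k)" "walks_total (Suc k) \<le> real m * walks_total k"
proof -
  show "walks_total k \<le> walks_total (Suc k)"
    unfolding walks_total_def by (intro sum_mono walks_mono) simp
  have "walks (Suc k) i \<le> walks_total k" if i: "i < m" for i
  proof -
    have "a i j * walks k j \<le> 1 * walks k j" if "j < m" for j
      using a_le_1[OF i that] walks_ge_1[OF that, of k] by (intro mult_right_mono) auto
    then show ?thesis unfolding walks_total_def by (auto intro!: sum_mono)
  qed
  then have "walks_total (Suc k) \<le> (\<Sum>i<m. walks_total k)"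
    unfolding walks_total_def[of "Suc k"] by (intro sum_mono) simp
  then show "walks_total (Suc k) \<le> real m * walks_total k" by simp
qed

text \<open>A further letter never decreases the count, since every letter has a successor, and
  multiplies it by at most m. This is the boundedness that \<open>chain_sum_limit\<close> asks
  for.\<close>

lemma ln_walks_diff_bound: "\<bar>ln_walks (Suc l) - ln_walks l\<bar> \<le> ln (real m)"
proof (cases l)
  case 0
  then show ?thesis using m_real by (simp add: ln_walks_def walks_total_def)
next
  case (Suc k)
  have pos: "walks_total k > 0" using walks_total_ge[of k] m_real by linarith
  then have "ln (walks_total k) \<le> ln (walks_total (Suc k))" using walks_total_Suc(1)[of k] by simp
  moreover have "ln (walks_total (Suc k)) \<le> ln (real m * walks_total k)"
    using walks_total_Suc[of k] pos by simp
  moreover have "ln (real m * walks_total k) = ln (real m) + ln (walks_total k)"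
    using pos m_real by (simp add: ln_mult)
  ultimately show ?thesis using Suc by (simp add: ln_walks_def)
qed

text \<open>For fixed \<open>n\<close>, the uniform distribution on the allowed words of length \<open>n\<close> is again of product
  form, with transition kernels given by ratios of numbers of walks; its total mass 1 yields the count.\<close>

lemma num_words_eq: "real (num_words n) = (\<Prod>k\<in>chain_roots q n. walks_total (chain_len q n k - 1))"
proof -
  \<comment> \<open>The number of ways to fill the rest of the chain after k up to n, given the
    letter at k.\<close>
  define G where "G = (\<lambda>k. walks (chain_len q n k - 1))"
  define c where "c = (\<lambda>k. walks_total (chain_len q n k - 1))"
  define w where "w = (\<lambda>k i j. if q dvd k then a i j * G k j / G (k div q) i else G k j / c k)"
  have Gpos: "G k i > 0" if "i < m" for k i using walks_ge_1[OF that, of "chain_len q n k - 1"] by (simp add: G_def)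
  have cpos: "c k > 0" for k using walks_total_ge[of "chain_len q n k - 1"] m_real by (simp add: c_def)
  have div_range: "k div q \<ge> 1" "q * (k div q) = k" if "k \<ge> 1" "q dvd k" for k
    using that q2 by (auto simp: Suc_le_eq div_greater_zero_iff dvd_imp_le)
  have "(\<Sum>u\<in>words m n. weight q w n u) = 1"
  proof (rule sum_weight_eq_1[OF q2 m_pos])
    fix k i assume k: "1 \<le> k" "k \<le> n" and i: "i < m"
    show "(\<Sum>j<m. w k i j) = 1"
    proof (cases "q dvd k")
      case True
      have "k div q \<le> n" using k(2) div_le_dividend[of k q] by linarith
      then have "chain_len q n (k div q) = Suc (chain_len q n k)"
        using chain_len_Suc[OF q2 div_range(1)[OF k(1) True], of n] div_range(2)[OF k(1) True] by simp
      moreover have "chain_len q n k = Suc (chain_len q n k - 1)" using chain_len_Suc[OF q2 k] by simp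
      ultimately have "G (k div q) i = (\<Sum>j<m. a i j * G k j)"
        unfolding G_def by (metis diff_Suc_1 walks.simps(2))
      then show ?thesis using True Gpos[OF i, of "k div q"] by (simp add: w_def flip: sum_divide_distrib)
    next
      case False
      have "(\<Sum>j<m. G k j) = c k" by (simp add: G_def c_def walks_total_def)
      then show ?thesis using False cpos[of k] by (simp add: w_def flip: sum_divide_distrib)
    qed
  qed
  \<comment> \<open>The factors G cancel along each chain, and G is 1 at the last member; only the
    constants at the roots remain, so all allowed words have equal weight.\<close>
  moreover have "weight q w n u = of_bool (allowed n u) / (\<Prod>k\<in>chain_roots q n. c k)" if u: "u \<in> words m n" for u
  proof -
    have less: "u k < m" for k using words_less[OF u m_pos] .
    have "weight q w n u = (\<Prod>k=1..n. (if q dvd k then a (u (k div q)) (u (q * (k div q))) else 1) * G k (u k) *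
        (if q dvd k then 1 / G (k div q) (u (k div q)) else 1 / c k))"
      unfolding weight_def by (intro prod.cong) (auto simp: w_def parent_def)
    also have "\<dots> = (\<Prod>k=1..n. if q dvd k then a (u (k div q)) (u (q * (k div q))) else 1) * (\<Prod>k=1..n. G k (u k)) *
        (\<Prod>k=1..n. if q dvd k then 1 / G (k div q) (u (k div q)) else 1 / c k)"
      by (simp only: prod.distrib)
    also have "(\<Prod>k=1..n. if q dvd k then a (u (k div q)) (u (q * (k div q))) else 1) =
        (\<Prod>k=1..n div q. a (u k) (u (q * k)))"
      using prod.split_by_parent[OF q_pos, of "\<lambda>k. a (u k) (u (q * k))" "\<lambda>_. 1" n] by simp
    also have "\<dots> = of_bool (allowed n u)"
    proof (cases "allowed n u")
      case True
      then show ?thesis by (simp add: allowed_def)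
    next
      case False
      then obtain k where k: "k \<in> {1..n div q}" "a (u k) (u (q * k)) \<noteq> 1"
        unfolding allowed_def by blast
      with a01[OF less less, of k "q * k"] have "a (u k) (u (q * k)) = 0" by blast
      with k(1) have "(\<Prod>k=1..n div q. a (u k) (u (q * k))) = 0" by (intro prod_zero) blast+
      with False show ?thesis by simp
    qed
    also have "(\<Prod>k=1..n. G k (u k)) = (\<Prod>k=1..n div q. G k (u k))"
    proof (rule prod.mono_neutral_right)
      show "\<forall>k\<in>{1..n} - {1..n div q}. G k (u k) = 1"
      proof
        fix k assume k: "k \<in> {1..n} - {1..n div q}"
        then have "\<not> k \<le> n div q" by auto
        then have "n < q * k"
          using q_pos less_eq_div_iff_mult_less_eq[of q k n] by (simp add: mult.commute)
        then have "chain_len q n k = 1" using chain_len_Suc[OF q2, of k n] k q2 by (simp add: chain_len_eq_0)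
        then show "G k (u k) = 1" by (simp add: G_def)
      qed
    qed auto
    also have "(\<Prod>k=1..n. if q dvd k then 1 / G (k div q) (u (k div q)) else 1 / c k) =
        (\<Prod>k=1..n div q. 1 / G k (u k)) * (\<Prod>k\<in>chain_roots q n. 1 / c k)"
      by (rule prod.split_by_parent[OF q_pos])
    also have "of_bool (allowed n u) * (\<Prod>k=1..n div q. G k (u k)) *
        ((\<Prod>k=1..n div q. 1 / G k (u k)) * (\<Prod>k\<in>chain_roots q n. 1 / c k)) =
        of_bool (allowed n u) * ((\<Prod>k=1..n div q. G k (u k) * (1 / G k (u k))) * (\<Prod>k\<in>chain_roots q n. 1 / c k))"
      by (simp only: prod.distrib mult.assoc)
    also have "(\<Prod>k=1..n div q. G k (u k) * (1 / G k (u k))) = 1"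
      using Gpos[OF less] by (intro prod.neutral) (simp add: less_imp_neq[symmetric])
    finally show ?thesis by (simp add: prod_dividef)
  qed
  ultimately have "(\<Sum>u\<in>words m n. of_bool (allowed n u) / (\<Prod>k\<in>chain_roots q n. c k)) = 1" by simp
  then have "(\<Sum>u\<in>words m n. of_bool (allowed n u)) / (\<Prod>k\<in>chain_roots q n. c k) = 1"
    by (simp only: sum_divide_distrib)
  moreover have "(\<Sum>u\<in>words m n. of_bool (allowed n u)) = real (num_words n)"
    by (simp add: num_words_def Int_def)
  moreover have "(\<Prod>k\<in>chain_roots q n. c k) > 0" by (intro prod_pos) (simp add: cpos)
  ultimately show ?thesis by (simp add: c_def)
qed

text \<open>The logarithm for each chain is written as a sum of increments over its members, so that
  the general limit of \<open>chain_sum\<close> applies.\<close>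

lemma ln_num_words: "ln (real (num_words n)) = chain_sum q (\<lambda>l. ln_walks (Suc l) - ln_walks l) n"
proof -
  have pos: "walks_total k > 0" for k using walks_total_ge[of k] m_real by linarith
  have "ln (real (num_words n)) = (\<Sum>k\<in>chain_roots q n. ln (walks_total (chain_len q n k - 1)))"
    unfolding num_words_eq by (intro ln_prod) (auto simp: pos less_imp_neq[symmetric])
  also have "\<dots> = (\<Sum>k\<in>chain_roots q n. \<Sum>l<chain_len q n k. ln_walks (Suc l) - ln_walks l)"
  proof (rule sum.cong)
    fix k assume "k \<in> chain_roots q n"
    then have "chain_len q n k = Suc (chain_len q n (q * k))" using q2 by (intro chain_len_Suc) (auto simp: chain_roots_def)
    then have "ln (walks_total (chain_len q n k - 1)) = ln_walks (chain_len q n k) - ln_walks 0"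
      by (simp add: ln_walks_def)
    then show "ln (walks_total (chain_len q n k - 1)) = (\<Sum>l<chain_len q n k. ln_walks (Suc l) - ln_walks l)"
      by (simp add: sum_lessThan_telescope)
  qed simp
  finally show ?thesis by (simp add: chain_sum_def)
qed

section \<open>Covering numbers and the Minkowski dimension\<close>

text \<open>A set of diameter at most \<delta> lies in a single cylinder of length n, so points
  extending distinct allowed words need distinct sets; the cylinders themselves attain this
  number.\<close>

lemma cover_num_X:
  assumes \<delta>: "real m powr - real n \<le> \<delta>" "\<delta> < real m powr (1 - real n)"
  shows "cover_num m \<delta> X = num_words n"
  unfolding cover_num_def
proof (rule Least_equality)
  define W where "W = {u \<in> words m n. allowed n u}"
  have fin: "finite W" by (simp add: W_def)
  obtain b where b: "bij_betw b {..<card W} W" using ex_bij_betw_nat_finite[OF fin] by (metis atLeast0LessThan)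
  show "\<exists>U. (\<forall>i<num_words n. U i \<subseteq> Sigma_seq m \<and> sdiam m (U i) \<le> \<delta>) \<and> X \<subseteq> (\<Union>i<num_words n. U i)"
  proof (intro exI conjI allI impI)
    show "cylinder m n (b i) \<subseteq> Sigma_seq m" for i by (rule cylinder_subset)
    show "sdiam m (cylinder m n (b i)) \<le> \<delta>" for i using sdiam_cylinder_le[OF m2] \<delta>(1) by (rule order_trans)
    show "X \<subseteq> (\<Union>i<num_words n. cylinder m n (b i))"
    proof
      fix x assume x: "x \<in> X"
      have "allowed n (truncate n x)" using X_allowed[OF x, of n] allowed_cong[of n "truncate n x" x] by (simp add: truncate_def)
      then have "truncate n x \<in> W" using X_truncate[OF x] by (simp add: W_def)
      then obtain i where i: "i < card W" "truncate n x = b i" using b by (auto simp: bij_betw_def)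
      have "x \<in> cylinder m n (truncate n x)" using x by (auto simp: cylinder_def truncate_def X_def)
      then show "x \<in> (\<Union>i<num_words n. cylinder m n (b i))" using i by (auto simp: num_words_def W_def)
    qed
  qed
  fix N :: nat assume "\<exists>U. (\<forall>i<N. U i \<subseteq> Sigma_seq m \<and> sdiam m (U i) \<le> \<delta>) \<and> X \<subseteq> (\<Union>i<N. U i)"
  then obtain U where U: "\<And>i. i < N \<Longrightarrow> U i \<subseteq> Sigma_seq m" "\<And>i. i < N \<Longrightarrow> sdiam m (U i) \<le> \<delta>" "X \<subseteq> (\<Union>i<N. U i)"
    by blast
  have "\<exists>x i. x \<in> X \<and> (\<forall>k\<le>n. x k = u k) \<and> i < N \<and> x \<in> U i" if "u \<in> W" for u
  proof -
    have "u \<in> words m n" "allowed n u" using that by (auto simp: W_def)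
    then obtain x where x: "x \<in> X" "\<And>k. k \<le> n \<Longrightarrow> x k = u k" using extend_word by blast
    then obtain i where "i < N" "x \<in> U i" using U(3) by blast
    with x show ?thesis by blast
  qed
  then obtain x i where xi: "\<And>u. u \<in> W \<Longrightarrow> x u \<in> X \<and> (\<forall>k\<le>n. x u k = u k) \<and> i u < N \<and> x u \<in> U (i u)" by metis
  have "inj_on i W"
  proof (rule inj_onI)
    fix u v assume uv: "u \<in> W" "v \<in> W" "i u = i v"
    have "rho m (x u) (x v) \<le> sdiam m (U (i u))"
      using xi[OF uv(1)] xi[OF uv(2)] uv(3) U(1) by (intro rho_le_sdiam[OF m2]) auto
    also have "\<dots> \<le> \<delta>" using U(2) xi[OF uv(1)] by blast
    finally have "\<forall>k\<le>n. x u k = x v k" using rho_less_iff[OF m2 \<delta>] by blast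
    with xi[OF uv(1)] xi[OF uv(2)] have "u k = v k" if "k \<le> n" for k using that by metis
    then have "truncate n u = truncate n v" by (simp add: truncate_def fun_eq_iff)
    moreover have "truncate n u = u" "truncate n v = v" using uv(1,2) by (auto simp: W_def intro: truncate_words_id)
    ultimately show "u = v" by metis
  qed
  moreover have "i ` W \<subseteq> {..<N}" using xi by blast
  ultimately have "card W \<le> card {..<N}" by (intro card_inj_on_le) auto
  then show "num_words n \<le> N" by (simp add: num_words_def W_def)
qed

lemma minkowski_dim_X:
  "minkowski_dim_eq m X ((1 - 1 / real q) * (\<Sum>l. (ln_walks (Suc l) - ln_walks l) / real q ^ l) / ln (real m))"
proof -
  define L where "L = (1 - 1 / real q) * (\<Sum>l. (ln_walks (Suc l) - ln_walks l) / real q ^ l)"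
  define y where "y = (\<lambda>\<delta>. - log (real m) \<delta>)"
  \<comment> \<open>For small \<delta> this is the length n with \<delta> at least m to the power -n
    and below m to the power 1 - n, as \<open>cover_num_X\<close> requires.\<close>
  define N where "N = (\<lambda>\<delta>. nat \<lceil>y \<delta>\<rceil>)"
  have lnm: "ln (real m) > 0" using m_real by simp
  have ylim: "filterlim y at_top (at_right 0)"
  proof -
    have "filterlim (\<lambda>\<delta>. - ln \<delta> * (1 / ln (real m))) at_top (at_right (0 :: real))"
      using lnm by (intro filterlim_at_top_mult_tendsto_pos[OF tendsto_const])
        (auto simp: filterlim_uminus_at_top intro!: ln_at_0)
    then show ?thesis by (simp add: y_def log_def)
  qed
  have Nlim: "filterlim N sequentially (at_right 0)"
  proof (rule filterlim_at_top[THEN iffD2], rule allI)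
    fix Z :: nat
    have "\<forall>\<^sub>F \<delta> in at_right 0. real Z \<le> y \<delta>" using ylim by (simp add: filterlim_at_top)
    then show "\<forall>\<^sub>F \<delta> in at_right 0. Z \<le> N \<delta>"
      unfolding N_def by eventually_elim linarith
  qed
  have "(\<lambda>n. ln (real (num_words n)) / real n) \<longlonglongrightarrow> L"
    unfolding ln_num_words L_def by (rule chain_sum_limit[OF q2 ln_walks_diff_bound])
  then have lim1: "((\<lambda>\<delta>. ln (real (num_words (N \<delta>))) / real (N \<delta>)) \<longlongrightarrow> L) (at_right 0)"
    by (rule filterlim_compose[OF _ Nlim])
  have ypos: "\<forall>\<^sub>F \<delta> in at_right 0. y \<delta> > 0" using ylim by (simp add: filterlim_at_top_dense)
  have bounds: "y \<delta> \<le> real (N \<delta>) \<and> real (N \<delta>) < y \<delta> + 1" if "y \<delta> > 0" for \<delta>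
    using that unfolding N_def by linarith
  have lim2: "((\<lambda>\<delta>. real (N \<delta>) / y \<delta>) \<longlongrightarrow> 1) (at_right 0)"
  proof (rule tendsto_sandwich)
    show "\<forall>\<^sub>F \<delta> in at_right 0. 1 \<le> real (N \<delta>) / y \<delta>"
      using ypos by eventually_elim (use bounds in auto)
    show "\<forall>\<^sub>F \<delta> in at_right 0. real (N \<delta>) / y \<delta> \<le> 1 + inverse (y \<delta>)"
      using ypos
    proof eventually_elim
      case (elim \<delta>)
      then have "real (N \<delta>) / y \<delta> \<le> (y \<delta> + 1) / y \<delta>" using bounds[OF elim] by (intro divide_right_mono) auto
      then show ?case using elim by (simp add: add_divide_distrib inverse_eq_divide)
    qed
    have "((\<lambda>\<delta>. inverse (y \<delta>)) \<longlongrightarrow> 0) (at_right 0)"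
      by (rule tendsto_inverse_0_at_top[OF ylim])
    then show "((\<lambda>\<delta>. 1 + inverse (y \<delta>)) \<longlongrightarrow> 1) (at_right 0)"
      using tendsto_add[OF tendsto_const, of _ 0 "at_right 0" 1] by simp
  qed simp
  have "((\<lambda>\<delta>. ln (real (num_words (N \<delta>))) / real (N \<delta>) * (real (N \<delta>) / y \<delta>) / ln (real m)) \<longlongrightarrow> L * 1 / ln (real m)) (at_right 0)"
    using lnm by (intro tendsto_divide tendsto_mult lim1 lim2 tendsto_const) auto
  moreover have "\<forall>\<^sub>F \<delta> in at_right 0. ln (real (num_words (N \<delta>))) / real (N \<delta>) * (real (N \<delta>) / y \<delta>) / ln (real m) =
      ln (real (cover_num m \<delta> X)) / - ln \<delta>"
    using ypos eventually_at_right_less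
  proof eventually_elim
    case (elim \<delta>)
    have \<delta>: "\<delta> = real m powr - y \<delta>" using elim m_real by (simp add: y_def powr_log_cancel)
    have b: "y \<delta> \<le> real (N \<delta>)" "real (N \<delta>) < y \<delta> + 1" using bounds elim by blast+
    have "real m powr - real (N \<delta>) \<le> real m powr - y \<delta>" using b m_real by (intro powr_mono) auto
    moreover have "real m powr - y \<delta> < real m powr (1 - real (N \<delta>))" using b m_real by (intro powr_less_mono) auto
    ultimately have "cover_num m \<delta> X = num_words (N \<delta>)" using \<delta> by (intro cover_num_X) auto
    moreover have "real (N \<delta>) > 0" using b elim by linarith
    moreover have "- ln \<delta> = y \<delta> * ln (real m)" using lnm by (simp add: y_def log_def)
    ultimately show ?case by simp
  qed
  ultimately have "((\<lambda>\<delta>. ln (real (cover_num m \<delta> X)) / - ln \<delta>) \<longlongrightarrow> L * 1 / ln (real m)) (at_right 0)"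
    by (rule Lim_transform_eventually)
  then show ?thesis by (simp add: minkowski_dim_eq_def L_def)
qed

end

text \<open>Summation by parts, used for logarithmic walk counts and for entropies alike. Bounded
  increments give linear growth of L, hence convergence. The exponent k + 2 belongs to a summation
  index starting at 0 instead of 1.\<close>

lemma geometric_abel_sum:
  fixes L :: "nat \<Rightarrow> real"
  assumes q: "q > 1" and L0: "L 0 = 0" and bound: "\<And>l. \<bar>L (Suc l) - L l\<bar> \<le> B"
  shows "summable (\<lambda>k. L (Suc k) / q ^ (k + 2))"
    and "(1 - 1 / q) * (\<Sum>l. (L (Suc l) - L l) / q ^ l) = (q - 1)\<^sup>2 * (\<Sum>k. L (Suc k) / q ^ (k + 2))"
proof -
  define f where "f = (\<lambda>k. L k / q ^ k)"
  have Lb: "\<bar>L k\<bar> \<le> B * real (Suc k)" for k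
  proof (induction k)
    case 0
    then show ?case using L0 bound[of 0] by simp
  next
    case (Suc k)
    then show ?case using bound[of k] by (simp add: algebra_simps)
  qed
  have "summable (\<lambda>k. real (Suc k) * (1 / q) ^ k)"
    using geometric_deriv_sums[of "1 / q"] q by (auto simp: sums_iff)
  then have "summable (\<lambda>k. B * (real (Suc k) * (1 / q) ^ k))" by (rule summable_mult)
  then have sf: "summable f"
  proof (rule summable_comparison_test')
    fix k
    have "\<bar>L k\<bar> / q ^ k \<le> B * real (Suc k) / q ^ k" using Lb[of k] q by (intro divide_right_mono) auto
    then show "norm (f k) \<le> B * (real (Suc k) * (1 / q) ^ k)" using q by (simp add: f_def power_one_over)
  qed
  then have sfS: "summable (\<lambda>k. f (Suc k))" by (simp only: summable_Suc_iff)
  define Z where "Z = (\<Sum>k. f (Suc k))"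
  have Z: "suminf f = Z" using suminf_split_head[OF sf] by (simp add: Z_def f_def L0)
  have e1: "L (Suc k) / q ^ (k + 2) = (1 / q) * f (Suc k)" for k by (simp add: f_def)
  show "summable (\<lambda>k. L (Suc k) / q ^ (k + 2))" unfolding e1 by (intro summable_mult sfS)
  have "(\<Sum>k. L (Suc k) / q ^ (k + 2)) = (1 / q) * Z" unfolding e1 Z_def by (rule suminf_mult[OF sfS])
  moreover have "(\<lambda>l. (L (Suc l) - L l) / q ^ l) = (\<lambda>l. q * f (Suc l) - f l)"
    using q by (auto simp: f_def diff_divide_distrib)
  then have "(\<Sum>l. (L (Suc l) - L l) / q ^ l) = q * Z - Z"
    using suminf_diff[OF summable_mult[OF sfS, of q] sf] suminf_mult[OF sfS, of q] Z by (simp add: Z_def)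
  moreover have "(1 - 1 / q) * (q * Z - Z) = (q - 1)\<^sup>2 * ((1 / q) * Z)"
    using q by (simp add: field_simps power2_eq_square)
  ultimately show "(1 - 1 / q) * (\<Sum>l. (L (Suc l) - L l) / q ^ l) = (q - 1)\<^sup>2 * (\<Sum>k. L (Suc k) / q ^ (k + 2))"
    by simp
qed

subsection \<open>The system \<open>t\<^sub>i\<^sup>q = \<Sum>\<^sub>j A(i,j) t\<^sub>j\<close>\<close>

context mult_shift
begin

text \<open>At an index maximising \<open>t i / t' i\<close>, with maximum l, the inequalities give
  \<open>l ^ q \<le> l\<close>, hence l is at most 1. This yields uniqueness, and it identifies the
  constant solution when row sums are equal.\<close>

lemma subsolution_le_supersolution:
  fixes t t' :: "nat \<Rightarrow> real"
  assumes pos: "\<And>i. i < m \<Longrightarrow> t i > 0" "\<And>i. i < m \<Longrightarrow> t' i > 0"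
    and sub: "\<And>i. i < m \<Longrightarrow> t i ^ q \<le> (\<Sum>j<m. a i j * t j)"
    and sup: "\<And>i. i < m \<Longrightarrow> (\<Sum>j<m. a i j * t' j) \<le> t' i ^ q"
    and i: "i < m"
  shows "t i \<le> t' i"
proof -
  define l where "l = Max ((\<lambda>i. t i / t' i) ` {..<m})"
  have fin: "finite ((\<lambda>i. t i / t' i) ` {..<m})" "(\<lambda>i. t i / t' i) ` {..<m} \<noteq> {}" using m_pos by auto
  obtain i0 where i0: "i0 < m" "l = t i0 / t' i0" using Max_in[OF fin] unfolding l_def by auto
  have le: "t j \<le> l * t' j" if "j < m" for j
  proof -
    have "t j / t' j \<le> l" unfolding l_def using that by (intro Max_ge fin(1)) auto
    then show ?thesis using pos(2)[OF that] by (simp add: divide_le_eq)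
  qed
  have l_pos: "l > 0" using i0 pos by simp
  have "l ^ q * t' i0 ^ q = t i0 ^ q" using i0 pos(2)[OF i0(1)] by (simp add: power_divide)
  also have "\<dots> \<le> (\<Sum>j<m. a i0 j * t j)" using sub[OF i0(1)] .
  also have "\<dots> \<le> (\<Sum>j<m. a i0 j * (l * t' j))"
    using le by (intro sum_mono mult_left_mono) (auto simp: a_nonneg i0)
  also have "\<dots> = l * (\<Sum>j<m. a i0 j * t' j)" by (simp add: sum_distrib_left algebra_simps)
  also have "\<dots> \<le> l * t' i0 ^ q" using sup[OF i0(1)] l_pos by (intro mult_left_mono) auto
  finally have "l ^ q \<le> l" using pos(2)[OF i0(1)] by simp
  have "l \<le> 1"
  proof (rule ccontr)
    assume "\<not> l \<le> 1"
    then have "l ^ 1 < l ^ q" using q2 by (intro power_strict_increasing) auto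
    with \<open>l ^ q \<le> l\<close> show False by simp
  qed
  then have "l * t' i \<le> 1 * t' i" using pos(2)[OF i] by (intro mult_right_mono) auto
  then show ?thesis using le[OF i] by simp
qed

text \<open>Monotone iteration from the subsolution 1. It stays below m because
  \<open>m * m \<le> m ^ q\<close>.\<close>

primrec approx_sol :: "nat \<Rightarrow> nat \<Rightarrow> real" where
  "approx_sol 0 = (\<lambda>i. 1)"
| "approx_sol (Suc n) = (\<lambda>i. root q (\<Sum>j<m. a i j * approx_sol n j))"

lemma approx_sol_props:
  assumes "i < m"
  shows "1 \<le> approx_sol n i \<and> approx_sol n i \<le> real m \<and> approx_sol n i \<le> approx_sol (Suc n) i"
  using assms
proof (induction n arbitrary: i)
  case 0
  have "(\<Sum>j<m. a i j) = walks 1 i" by simp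
  then have "(\<Sum>j<m. a i j) \<ge> 1" using walks_ge_1[OF 0, of 1] by linarith
  then show ?case using q_pos m_real by simp
next
  case (Suc n)
  have "approx_sol (Suc n) i \<le> root q (real m ^ q)"
    unfolding approx_sol.simps
  proof (rule real_root_le_mono)
    have "(\<Sum>j<m. a i j * approx_sol n j) \<le> (\<Sum>j<m. 1 * real m)"
      using Suc a_nonneg a_le_1 by (intro sum_mono mult_mono) (force intro: order_trans[of 0 1])+
    also have "\<dots> = real m ^ 2" by (simp add: power2_eq_square)
    also have "\<dots> \<le> real m ^ q" using q2 m_real by (intro power_increasing) auto
    finally show "(\<Sum>j<m. a i j * approx_sol n j) \<le> real m ^ q" .
  qed (use q_pos in auto)
  then have 1: "approx_sol (Suc n) i \<le> real m" using q_pos m_real by (simp add: real_root_power_cancel)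
  have 2: "approx_sol (Suc n) i \<le> approx_sol (Suc (Suc n)) i"
    unfolding approx_sol.simps(2)[of "Suc n"] approx_sol.simps(2)[of n]
  proof (rule real_root_le_mono)
    show "(\<Sum>j<m. a i j * approx_sol n j) \<le>
        (\<Sum>j<m. a i j * root q (\<Sum>k<m. a j k * approx_sol n k))"
      using Suc by (intro sum_mono mult_left_mono) (auto simp: a_nonneg)
  qed (use q_pos in auto)
  show ?case using Suc.IH[OF Suc.prems] 1 2 by linarith
qed

lemma ex_solution:
  assumes branching: "\<And>i. i < m \<Longrightarrow> \<exists>k. walks k i \<noteq> 1"
  obtains t where "\<And>i. i < m \<Longrightarrow> t i > 1" "\<And>i. i < m \<Longrightarrow> t i ^ q = (\<Sum>j<m. a i j * t j)"
proof -
  define t where "t = (\<lambda>i. lim (\<lambda>n. approx_sol n i))"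
  have lim: "(\<lambda>n. approx_sol n i) \<longlonglongrightarrow> t i" if i: "i < m" for i
  proof -
    have "incseq (\<lambda>n. approx_sol n i)" using approx_sol_props[OF i] by (intro incseq_SucI) blast
    moreover have "approx_sol n i \<le> real m" for n using approx_sol_props[OF i] by blast
    ultimately have "convergent (\<lambda>n. approx_sol n i)" by (metis convergentI incseq_convergent)
    then show ?thesis unfolding t_def by (simp add: convergent_LIMSEQ_iff)
  qed
  have ge: "t i \<ge> 1" if i: "i < m" for i
    using approx_sol_props[OF i] by (intro LIMSEQ_le_const[OF lim[OF i]]) blast
  have eq: "t i ^ q = (\<Sum>j<m. a i j * t j)" if i: "i < m" for i
  proof (rule LIMSEQ_unique)
    have "(\<lambda>n. approx_sol (Suc n) i ^ q) \<longlonglongrightarrow> t i ^ q"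
      by (intro tendsto_power LIMSEQ_Suc lim i)
    moreover have "approx_sol (Suc n) i ^ q = (\<Sum>j<m. a i j * approx_sol n j)" for n
    proof -
      have "0 \<le> (\<Sum>j<m. a i j * approx_sol n j)"
        using approx_sol_props[of _ n] by (intro sum_nonneg mult_nonneg_nonneg) (force simp: a_nonneg i)+
      then show ?thesis using q_pos by simp
    qed
    ultimately show "(\<lambda>n. \<Sum>j<m. a i j * approx_sol n j) \<longlonglongrightarrow> t i ^ q" by simp
    show "(\<lambda>n. \<Sum>j<m. a i j * approx_sol n j) \<longlonglongrightarrow> (\<Sum>j<m. a i j * t j)"
      by (intro tendsto_sum tendsto_mult tendsto_const lim) auto
  qed
  \<comment> \<open>The limit only gives \<open>t i \<ge> 1\<close>. Equality forces a single
    successor, again with value 1, so just one walk of each length starts at i, contrary to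
    \<open>branching\<close>.\<close>
  have "walks k i = 1" if "i < m" "t i = 1" for k i
    using that
  proof (induction k arbitrary: i)
    case (Suc k)
    obtain j where j: "j < m" "a i j = 1" using row[OF Suc.prems(1)] by blast
    have nonneg: "a i l * t l \<ge> 0" if "l < m" for l
      using a_nonneg[OF Suc.prems(1) that] ge[OF that] by simp
    have "1 = (\<Sum>l<m. a i l * t l)" using eq[OF Suc.prems(1)] Suc.prems(2) by simp
    also have "\<dots> = t j + (\<Sum>l\<in>{..<m} - {j}. a i l * t l)" using j by (simp add: sum.remove)
    finally have "t j = 1" and rest: "(\<Sum>l\<in>{..<m} - {j}. a i l * t l) = 0"
      using ge[OF j(1)] sum_nonneg[of "{..<m} - {j}" "\<lambda>l. a i l * t l"] nonneg by auto
    have "a i l = 0" if "l \<in> {..<m} - {j}" for l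
    proof -
      have "a i l * t l = 0" using rest nonneg that by (subst (asm) sum_nonneg_eq_0_iff) auto
      then show ?thesis using ge[of l] that by auto
    qed
    then have "walks (Suc k) i = a i j * walks k j" using j by (simp add: sum.remove)
    then show ?case using Suc.IH[OF j(1) \<open>t j = 1\<close>] j by simp
  qed simp
  then have "t i > 1" if "i < m" for i using ge[OF that] branching[OF that] that by (metis less_eq_real_def)
  then show ?thesis using that eq by blast
qed

definition mdim :: real where
  "mdim = (real q - 1)\<^sup>2 * (\<Sum>k. log (real m) (walks_total k) / real q ^ (k + 2))"

lemma mdim_ln: "mdim * ln (real m) = (real q - 1)\<^sup>2 * (\<Sum>k. ln_walks (Suc k) / real q ^ (k + 2))"
proof -
  have sm: "summable (\<lambda>k. ln_walks (Suc k) / real q ^ (k + 2))"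
    by (rule geometric_abel_sum(1)[where B = "ln (real m)"]) (use q_real ln_walks_diff_bound in \<open>auto simp: ln_walks_def\<close>)
  have "(\<lambda>k. log (real m) (walks_total k) / real q ^ (k + 2)) = (\<lambda>k. ln_walks (Suc k) / real q ^ (k + 2) / ln (real m))"
    by (simp add: fun_eq_iff ln_walks_def log_def)
  then show ?thesis using suminf_divide[OF sm, of "ln (real m)"] m_real by (simp add: mdim_def)
qed

lemma minkowski_dim_mdim: "minkowski_dim_eq m X mdim"
proof -
  have "(1 - 1 / real q) * (\<Sum>l. (ln_walks (Suc l) - ln_walks l) / real q ^ l) = mdim * ln (real m)"
    unfolding mdim_ln
    by (rule geometric_abel_sum(2)[where B = "ln (real m)"]) (use q_real ln_walks_diff_bound in \<open>auto simp: ln_walks_def\<close>)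
  then show ?thesis using minkowski_dim_X m_real by simp
qed

end

text \<open>The finite variational principle: entropy plus the mean of \<open>ln b\<close> is at
  most the logarithm of the total weight, from \<open>ln x \<le> x - 1\<close> term by term. Terms
  with \<open>p j = 0\<close> vanish, so b may be 0 there.\<close>

lemma gibbs_inequality:
  fixes p b :: "'a \<Rightarrow> real"
  assumes "finite J" "\<And>j. j \<in> J \<Longrightarrow> p j \<ge> 0" "sum p J = 1"
    and "\<And>j. j \<in> J \<Longrightarrow> b j \<ge> 0" "\<And>j. j \<in> J \<Longrightarrow> p j > 0 \<Longrightarrow> b j > 0" "sum b J > 0"
  shows "(\<Sum>j\<in>J. p j * (ln (b j) - ln (p j))) \<le> ln (sum b J)"
proof -
  define B where "B = sum b J"
  have "p j * (ln (b j) - ln (p j)) - p j * ln B \<le> b j / B - p j" if j: "j \<in> J" for j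
  proof (cases "p j = 0")
    case False
    with assms(2)[OF j] have pos: "p j > 0" by simp
    then have bpos: "b j > 0" using assms(5)[OF j] by simp
    have B: "B > 0" using assms(6) by (simp add: B_def)
    have "ln (b j / (p j * B)) \<le> b j / (p j * B) - 1" using pos bpos B by (intro ln_le_minus_one) simp
    also have "ln (b j / (p j * B)) = ln (b j) - ln (p j) - ln B" using pos bpos B by (simp add: ln_div ln_mult)
    finally have "p j * (ln (b j) - ln (p j) - ln B) \<le> p j * (b j / (p j * B) - 1)" using pos by (intro mult_left_mono) auto
    then show ?thesis using pos B by (simp add: right_diff_distrib)
  qed (use assms j in \<open>auto simp: B_def\<close>)
  then have "(\<Sum>j\<in>J. p j * (ln (b j) - ln (p j)) - p j * ln B) \<le> (\<Sum>j\<in>J. b j / B - p j)" by (rule sum_mono)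
  also have "\<dots> = 0" using assms(3,6) by (simp add: sum_subtractf B_def flip: sum_divide_distrib)
  finally show ?thesis using assms(3) by (simp add: sum_subtractf B_def flip: sum_distrib_right)
qed

subsection \<open>Comparison of the two dimensions\<close>

context mult_shift_solution
begin

text \<open>\<open>entropy k\<close> is the entropy of the first \<open>k\<close> coordinates of the Markov chain with initial
  distribution \<open>p0\<close> and transition matrix \<open>p\<close>; it is at most the logarithm of the number of walks.\<close>

definition entropy :: "nat \<Rightarrow> real" where
  "entropy k = (case k of 0 \<Rightarrow> 0 | Suc k \<Rightarrow> ln T - g 0 + (\<Sum>l<k. real q * g l - g (Suc l)))"

lemma entropy_diff_bound: "\<bar>entropy (Suc l) - entropy l\<bar> \<le> (1 + real q) * ln T"
proof (cases l)
  case 0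
  have "0 \<le> real q * ln T" using lnT_pos by simp
  then show ?thesis using 0 g_bounds[of 0] by (simp add: entropy_def algebra_simps)
next
  case (Suc k)
  have "0 \<le> real q * g k" "real q * g k \<le> real q * ln T" using g_bounds[of k] by (auto intro: mult_left_mono)
  then show ?thesis using Suc g_bounds[of "Suc k"] by (simp add: entropy_def algebra_simps abs_le_iff)
qed

text \<open>The entropy of one further step is \<open>q * g l - g (Suc l)\<close>; divided by
  \<open>q ^ Suc l\<close> it is a difference of consecutive values of \<open>g l / q ^ l\<close>.
  The discounted increments therefore telescope to \<open>ln T\<close>, and summation by parts gives
  the stated form.\<close>

lemma hdim_eq_entropy_sum: "hdim * ln (real m) = (real q - 1)\<^sup>2 * (\<Sum>k. entropy (Suc k) / real q ^ (k + 2))"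
proof -
  define F where "F = (\<lambda>l. g l / real q ^ l)"
  have "F \<longlonglongrightarrow> 0"
  proof (rule Lim_null_comparison)
    show "\<forall>\<^sub>F l in sequentially. norm (F l) \<le> ln T * (1 / real q) ^ l"
      using abs_g_le q_real by (intro always_eventually allI) (simp add: F_def power_one_over divide_right_mono)
    have "(\<lambda>l. (1 / real q) ^ l) \<longlonglongrightarrow> 0" using q_real by (intro LIMSEQ_power_zero) auto
    then show "(\<lambda>l. ln T * (1 / real q) ^ l) \<longlonglongrightarrow> 0" using tendsto_mult_left_zero[of _ _ "ln T"] by (simp add: tendsto_mult_right_zero)
  qed
  then have "(\<lambda>k. F k - F (Suc k)) sums (F 0 - 0)" by (rule telescope_sums')
  moreover have "(entropy (Suc (Suc k)) - entropy (Suc k)) / real q ^ Suc k = F k - F (Suc k)" for k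
    using q_real by (simp add: entropy_def F_def diff_divide_distrib)
  ultimately have "(\<lambda>k. (entropy (Suc (Suc k)) - entropy (Suc k)) / real q ^ Suc k) sums g 0" by (simp add: F_def)
  then have "(\<lambda>k. (entropy (Suc k) - entropy k) / real q ^ k) sums (g 0 + (entropy (Suc 0) - entropy 0) / real q ^ 0)"
    by (rule sums_Suc)
  then have "(\<Sum>k. (entropy (Suc k) - entropy k) / real q ^ k) = ln T" by (simp add: entropy_def sums_iff)
  then show ?thesis unfolding hdim_ln
    using geometric_abel_sum(2)[OF q_real, of entropy, OF _ entropy_diff_bound] by (simp add: entropy_def)
qed

text \<open>The left side is the entropy of k steps of the Markov chain started at i. The first step
  is split off, the induction hypothesis bounds the rest, and Gibbs with weights
  \<open>a i j * walks k j\<close> handles the choice of the first step.\<close>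

lemma ln_walks_ge: "i < m \<Longrightarrow> (\<Sum>l<k. real q * cond_exp l i - cond_exp (Suc l) i) \<le> ln (walks k i)"
proof (induction k arbitrary: i)
  case (Suc k)
  define h where "h = (\<lambda>i. \<Sum>l<k. real q * cond_exp l i - cond_exp (Suc l) i)"
  have "(\<Sum>l<Suc k. real q * cond_exp l i - cond_exp (Suc l) i) =
      real q * ln (t i) - cond_exp 1 i + (\<Sum>l<k. real q * cond_exp (Suc l) i - cond_exp (Suc (Suc l)) i)"
    by (subst sum.lessThan_Suc_shift) simp
  also have "(\<Sum>l<k. real q * cond_exp (Suc l) i - cond_exp (Suc (Suc l)) i) = (\<Sum>j<m. p i j * h j)"
  proof -
    have "(\<Sum>j<m. p i j * h j) = (\<Sum>l<k. \<Sum>j<m. p i j * (real q * cond_exp l j - cond_exp (Suc l) j))"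
      unfolding h_def sum_distrib_left by (rule sum.swap)
    also have "\<dots> = (\<Sum>l<k. real q * cond_exp (Suc l) i - cond_exp (Suc (Suc l)) i)"
    proof (rule sum.cong)
      fix l
      have "(\<Sum>j<m. p i j * (real q * cond_exp l j - cond_exp (Suc l) j)) =
          real q * (\<Sum>j<m. p i j * cond_exp l j) - (\<Sum>j<m. p i j * cond_exp (Suc l) j)"
        by (simp only: right_diff_distrib sum_subtractf sum_distrib_left mult.left_commute)
      then show "(\<Sum>j<m. p i j * (real q * cond_exp l j - cond_exp (Suc l) j)) =
          real q * cond_exp (Suc l) i - cond_exp (Suc (Suc l)) i"
        by (simp only: cond_exp.simps(2))
    qed simp
    finally show ?thesis by simp
  qed
  also have "(\<Sum>j<m. p i j * h j) \<le> (\<Sum>j<m. p i j * ln (walks k j))"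
    using Suc unfolding h_def by (intro sum_mono mult_left_mono) (auto simp: p_nonneg)
  also have "real q * ln (t i) - cond_exp 1 i + (\<Sum>j<m. p i j * ln (walks k j)) =
      (\<Sum>j<m. p i j * (ln (walks k j) - ln (t j) + real q * ln (t i)))"
    using sum_p[OF Suc.prems]
    by (simp add: distrib_left right_diff_distrib sum.distrib sum_subtractf flip: sum_distrib_right)
  also have "\<dots> = (\<Sum>j<m. p i j * (ln (a i j * walks k j) - ln (p i j)))"
  proof (rule sum.cong)
    fix j assume "j \<in> {..<m}"
    then have j: "j < m" by simp
    show "p i j * (ln (walks k j) - ln (t j) + real q * ln (t i)) = p i j * (ln (a i j * walks k j) - ln (p i j))"
    proof (cases "a i j = 0")
      case False
      then have "a i j = 1" using a01[OF Suc.prems j] by simp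
      moreover have "ln (t j / t i ^ q) = ln (t j) - real q * ln (t i)"
        using t_pos[OF j] t_pos[OF Suc.prems] by (simp add: ln_div ln_realpow)
      ultimately show ?thesis by (simp add: p_def)
    qed (simp add: p_def)
  qed simp
  also have "\<dots> \<le> ln (\<Sum>j<m. a i j * walks k j)"
  proof (rule gibbs_inequality)
    show "sum (p i) {..<m} = 1" using sum_p[OF Suc.prems] .
    have wpos: "walks k j > 0" if "j < m" for j using walks_ge_1[OF that, of k] by simp
    show "a i j * walks k j \<ge> 0" if "j \<in> {..<m}" for j using that a_nonneg[OF Suc.prems, of j] wpos[of j] by simp
    show "a i j * walks k j > 0" if "j \<in> {..<m}" "p i j > 0" for j
      using that a01[OF Suc.prems, of j] wpos[of j] by (auto simp: p_def)
    show "(\<Sum>j<m. a i j * walks k j) > 0" using walks_ge_1[OF Suc.prems, of "Suc k"] by simp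
  qed (use Suc.prems in \<open>auto simp: p_nonneg\<close>)
  finally show ?case by simp
qed simp

lemma ln_p0: "j < m \<Longrightarrow> ln (p0 j) = ln (t j) - ln T"
  using t_pos[of j] T_gt_1 by (simp add: p0_def ln_div)

lemma p0_pos: "j < m \<Longrightarrow> p0 j > 0"
  using t_pos[of j] T_gt_1 by (simp add: p0_def)

text \<open>One more application of Gibbs, now for the initial distribution with weights
  \<open>walks k j\<close>.\<close>

lemma entropy_le_ln_walks: "entropy (Suc k) \<le> ln_walks (Suc k)"
proof -
  define h where "h = (\<lambda>i. \<Sum>l<k. real q * cond_exp l i - cond_exp (Suc l) i)"
  have "(\<Sum>l<k. real q * g l - g (Suc l)) = (\<Sum>j<m. p0 j * h j)"
  proof -
    have "(\<Sum>j<m. p0 j * h j) = (\<Sum>l<k. \<Sum>j<m. p0 j * (real q * cond_exp l j - cond_exp (Suc l) j))"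
      unfolding h_def sum_distrib_left by (rule sum.swap)
    also have "\<dots> = (\<Sum>l<k. real q * g l - g (Suc l))"
      by (simp only: g_def right_diff_distrib sum_subtractf sum_distrib_left mult.left_commute)
    finally show ?thesis by simp
  qed
  also have "\<dots> \<le> (\<Sum>j<m. p0 j * ln (walks k j))"
    using ln_walks_ge unfolding h_def by (intro sum_mono mult_left_mono) (auto simp: p0_nonneg)
  finally have "entropy (Suc k) \<le> ln T - g 0 + (\<Sum>j<m. p0 j * ln (walks k j))" by (simp add: entropy_def)
  also have "\<dots> = (\<Sum>j<m. p0 j * (ln (walks k j) - (ln (t j) - ln T)))"
    using sum_p0 by (simp add: g_def right_diff_distrib sum_subtractf flip: sum_distrib_right)
  also have "\<dots> = (\<Sum>j<m. p0 j * (ln (walks k j) - ln (p0 j)))" by (intro sum.cong) (auto simp: ln_p0)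
  also have "\<dots> \<le> ln (\<Sum>j<m. walks k j)"
  proof (rule gibbs_inequality)
    have wpos: "walks k j > 0" if "j < m" for j using walks_ge_1[OF that, of k] by simp
    then show "walks k j \<ge> 0" "walks k j > 0" if "j \<in> {..<m}" for j using that by (auto intro: less_imp_le)
    show "(\<Sum>j<m. walks k j) > 0" using walks_total_ge[of k] m_real by (simp add: walks_total_def)
  qed (auto simp: p0_nonneg sum_p0)
  finally show ?thesis by (simp add: ln_walks_def walks_total_def)
qed

lemma uniform_if_entropy_max:
  assumes "entropy (Suc 0) = ln_walks (Suc 0)" "j < m"
  shows "t j = T / real m"
proof -
  \<comment> \<open>The terms of the relative entropy of \<open>p0\<close> with respect to the
    uniform distribution. Subtracting \<open>p0 j - 1 / m\<close>, which sums to 0, makes each term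
    nonnegative, so a zero total forces every term to vanish.\<close>
  define F where "F = (\<lambda>j. p0 j * (ln (real m) + ln (p0 j)) - (p0 j - 1 / real m))"
  have x: "ln (real m) + ln (p0 j) = - ln (1 / (real m * p0 j))" if "j < m" for j
    using p0_pos[OF that] m_real by (simp add: ln_div ln_mult)
  have F_nonneg: "F j \<ge> 0" if j: "j < m" for j
  proof -
    have "ln (1 / (real m * p0 j)) \<le> 1 / (real m * p0 j) - 1" using p0_pos[OF j] m_real by (intro ln_le_minus_one) simp
    then have "p0 j * ln (1 / (real m * p0 j)) \<le> p0 j * (1 / (real m * p0 j) - 1)"
      using p0_pos[OF j] by (intro mult_left_mono) auto
    then show ?thesis using p0_pos[OF j] unfolding F_def x[OF j] by (simp add: right_diff_distrib)
  qed
  have "(\<Sum>j<m. F j) = (\<Sum>j<m. p0 j * (ln (real m) + ln (p0 j))) - ((\<Sum>j<m. p0 j) - (\<Sum>j<m. 1 / real m))"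
    by (simp only: F_def sum_subtractf)
  also have "(\<Sum>j<m. p0 j) - (\<Sum>j<m. 1 / real m) = 0" using m_real by (simp add: sum_p0)
  also have "(\<Sum>j<m. p0 j * (ln (real m) + ln (p0 j))) = (\<Sum>j<m. p0 j * (ln (real m) - ln T + ln (t j)))"
    by (intro sum.cong) (auto simp: ln_p0)
  also have "\<dots> = ln (real m) - ln T + g 0"
    using sum_p0 by (simp add: distrib_left sum.distrib g_def flip: sum_distrib_right)
  also have "\<dots> = 0" using assms(1) by (simp add: entropy_def ln_walks_def walks_total_def)
  finally have "(\<Sum>j<m. F j) = 0" by simp
  then have "F j = 0" using assms(2) F_nonneg by (subst (asm) sum_nonneg_eq_0_iff) auto
  then have "p0 j * (- ln (1 / (real m * p0 j))) = p0 j * (1 - 1 / (real m * p0 j))"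
    using p0_pos[OF assms(2)] unfolding F_def x[OF assms(2)] by (simp add: right_diff_distrib)
  then have "- ln (1 / (real m * p0 j)) = 1 - 1 / (real m * p0 j)"
    using p0_pos[OF assms(2)] by (subst (asm) mult_cancel_left) simp
  then have "ln (1 / (real m * p0 j)) = 1 / (real m * p0 j) - 1" by linarith
  then have "1 / (real m * p0 j) = 1"
    using p0_pos[OF assms(2)] m_real by (intro ln_eq_minus_one) auto
  then show ?thesis using T_gt_1 m_real by (simp add: p0_def field_simps)
qed

text \<open>Equal sums of termwise ordered series have equal terms; already the term k = 0 makes the
  initial distribution uniform, hence t constant, and the system then reads off equal row sums.
  Conversely, equal row sums make all transition and initial probabilities uniform on the available
  choices, so every entropy is maximal.\<close>

lemma hdim_eq_mdim_iff: "hdim = mdim \<longleftrightarrow> (\<exists>c. \<forall>i<m. (\<Sum>j<m. a i j) = c)"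
proof
  assume eq: "hdim = mdim"
  define D where "D = (\<lambda>k. ln_walks (Suc k) / real q ^ (k + 2) - entropy (Suc k) / real q ^ (k + 2))"
  have s1: "summable (\<lambda>k. ln_walks (Suc k) / real q ^ (k + 2))"
    by (rule geometric_abel_sum(1)[where B = "ln (real m)"]) (use q_real ln_walks_diff_bound in \<open>auto simp: ln_walks_def\<close>)
  have s2: "summable (\<lambda>k. entropy (Suc k) / real q ^ (k + 2))"
    by (rule geometric_abel_sum(1)[where B = "(1 + real q) * ln T"]) (use q_real entropy_diff_bound in \<open>auto simp: entropy_def\<close>)
  have "suminf D = 0"
    unfolding D_def suminf_diff[OF s1 s2, symmetric]
    using hdim_eq_entropy_sum mdim_ln eq q_real by simp
  moreover have "D k \<ge> 0" for k
    unfolding D_def diff_divide_distrib[symmetric] using entropy_le_ln_walks[of k] by simp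
  moreover have "summable D" unfolding D_def by (rule summable_diff[OF s1 s2])
  ultimately have "D 0 = 0" using suminf_eq_zero_iff[of D] by blast
  then have "entropy (Suc 0) = ln_walks (Suc 0)" using q_real by (simp add: D_def)
  then have t: "t j = T / real m" if "j < m" for j using uniform_if_entropy_max that by blast
  have "(\<Sum>j<m. a i j) = (T / real m) ^ q / (T / real m)" if i: "i < m" for i
  proof -
    have "(T / real m) ^ q = (\<Sum>j<m. a i j) * (T / real m)"
      using t_eq[OF i] t i unfolding sum_distrib_right by simp
    then show ?thesis using T_gt_1 m_real by simp
  qed
  then show "\<exists>c. \<forall>i<m. (\<Sum>j<m. a i j) = c" by blast
next
  assume "\<exists>c. \<forall>i<m. (\<Sum>j<m. a i j) = c"
  then obtain c where c: "\<And>i. i < m \<Longrightarrow> (\<Sum>j<m. a i j) = c" by blast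
  have "walks 1 0 = c" using c[OF m_pos] by simp
  then have c1: "c \<ge> 1" using walks_ge_1[OF m_pos, of 1] by simp
  \<comment> \<open>A constant solution must satisfy \<open>b ^ q = c * b\<close>, and comparison
    shows that t equals it.\<close>
  define b where "b = root (q - 1) c"
  have b: "b > 0" "b ^ (q - 1) = c" using c1 q2 by (auto simp: b_def)
  have bq: "b ^ q = c * b" using b q2 by (metis Suc_diff_1 Suc_1 less_le_trans zero_less_Suc power_Suc2)
  have sb: "(\<Sum>j<m. a i j * b) = b ^ q" if "i < m" for i using c[OF that] bq by (simp flip: sum_distrib_right)
  have tb: "t i = b" if i: "i < m" for i
  proof (rule antisym)
    show "t i \<le> b" by (rule subsolution_le_supersolution[of t "\<lambda>_. b"]) (use i b sb t_pos t_eq in auto)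
    show "b \<le> t i" by (rule subsolution_le_supersolution[of "\<lambda>_. b" t]) (use i b sb t_pos t_eq in auto)
  qed
  have lnc: "ln c = (real q - 1) * ln b" using b q2 by (metis ln_realpow of_nat_1 of_nat_diff q_pos)
  have ce: "cond_exp l i = ln b" if "i < m" for l i
    using that
  proof (induction l arbitrary: i)
    case (Suc l)
    then show ?case using sum_p[OF Suc.prems] by (simp flip: sum_distrib_right)
  qed (simp add: tb)
  have g: "g l = ln b" for l using sum_p0 by (simp add: g_def ce flip: sum_distrib_right)
  have w: "walks k i = c ^ k" if "i < m" for k i
    using that
  proof (induction k arbitrary: i)
    case (Suc k)
    then show ?case using c[OF Suc.prems] by (simp flip: sum_distrib_right)
  qed simp
  have "T = real m * b" by (simp add: T_def tb)
  then have lnT: "ln T = ln (real m) + ln b" using b m_real by (simp add: ln_mult)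
  have "entropy (Suc k) = ln_walks (Suc k)" for k
  proof -
    have "ln_walks (Suc k) = ln (real m * c ^ k)" by (simp add: ln_walks_def walks_total_def w)
    also have "\<dots> = ln (real m) + real k * ((real q - 1) * ln b)" using c1 m_real lnc by (simp add: ln_mult ln_realpow)
    finally show ?thesis by (simp add: entropy_def g lnT algebra_simps)
  qed
  then have "hdim * ln (real m) = mdim * ln (real m)" unfolding hdim_eq_entropy_sum mdim_ln by simp
  then show "hdim = mdim" using m_real by simp
qed

end

subsection \<open>Matrix powers\<close>

text \<open>\<open>A ^\<^sub>m Suc k\<close> has its new factor on the right, whereas
  \<open>walks\<close> splits off the first step and needs the factor on the left.\<close>

lemma pow_mat_mult_vec_Suc:
  fixes A :: "'a :: comm_ring_1 mat"
  assumes A: "A \<in> carrier_mat n n" and v: "v \<in> carrier_vec n"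
  shows "A ^\<^sub>m Suc k *\<^sub>v v = A *\<^sub>v (A ^\<^sub>m k *\<^sub>v v)"
proof -
  have Ak: "A ^\<^sub>m k \<in> carrier_mat n n" for k using A by (rule pow_carrier_mat)
  have step: "A ^\<^sub>m Suc k *\<^sub>v v = A ^\<^sub>m k *\<^sub>v (A *\<^sub>v v)" if "v \<in> carrier_vec n" for k v
    using assoc_mult_mat_vec[OF Ak A that] by simp
  have "A ^\<^sub>m k *\<^sub>v (A *\<^sub>v v) = A *\<^sub>v (A ^\<^sub>m k *\<^sub>v v)"
    using v
  proof (induction k arbitrary: v)
    case 0
    then show ?case using A by simp
  next
    case (Suc k)
    have Av: "A *\<^sub>v v \<in> carrier_vec n" using A Suc.prems by (rule mult_mat_vec_carrier)
    show ?case using Suc.IH[OF Av] by (simp only: step[OF Av] step[OF Suc.prems])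
  qed
  then show ?thesis by (simp only: step[OF v])
qed

lemma pow_mat_ones_index:
  assumes A: "A \<in> carrier_mat m m" and i: "i < m"
  shows "(A ^\<^sub>m k *\<^sub>v ones_vec m) $ i = (\<Sum>j<m. (A ^\<^sub>m k) $$ (i, j))"
  using carrier_matD[OF pow_carrier_mat[OF A, of k]] i
  by (simp add: ones_vec_def scalar_prod_def atLeast0LessThan)

lemma pow_mat_ones_Suc_index:
  assumes A: "A \<in> carrier_mat m m" and i: "i < m"
  shows "(A ^\<^sub>m Suc k *\<^sub>v ones_vec m) $ i = (\<Sum>j<m. A $$ (i, j) * (A ^\<^sub>m k *\<^sub>v ones_vec m) $ j)"
proof -
  have v: "ones_vec m \<in> carrier_vec m" by (simp add: ones_vec_def)
  have "A ^\<^sub>m k *\<^sub>v ones_vec m \<in> carrier_vec m" using pow_carrier_mat[OF A] v by (rule mult_mat_vec_carrier)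
  then show ?thesis unfolding pow_mat_mult_vec_Suc[OF A v]
    using A i by (auto simp: scalar_prod_def atLeast0LessThan intro!: sum.cong)
qed

lemma pow_mat_Nats:
  fixes A :: "real mat"
  assumes A: "A \<in> carrier_mat m m" and "\<And>i j. i < m \<Longrightarrow> j < m \<Longrightarrow> A $$ (i, j) \<in> \<nat>"
    and "i < m" "j < m"
  shows "(A ^\<^sub>m k) $$ (i, j) \<in> \<nat>"
  using assms(3,4)
proof (induction k arbitrary: i j)
  case 0
  then show ?case using A by simp
next
  case (Suc k)
  have "(A ^\<^sub>m Suc k) $$ (i, j) = (\<Sum>l<m. (A ^\<^sub>m k) $$ (i, l) * A $$ (l, j))"
    using A pow_carrier_mat[OF A, of k] Suc.prems by (auto simp: scalar_prod_def atLeast0LessThan intro!: sum.cong)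
  also have "\<dots> \<in> \<nat>"
  proof -
    have "(\<Sum>l\<in>L. (A ^\<^sub>m k) $$ (i, l) * A $$ (l, j)) \<in> \<nat>" if "finite L" "L \<subseteq> {..<m}" for L
      using that
    proof (induction L rule: finite_induct)
      case (insert l L)
      then have "(A ^\<^sub>m k) $$ (i, l) * A $$ (l, j) \<in> \<nat>" using Suc.IH Suc.prems assms(2) by (intro Nats_mult) auto
      with insert show ?case by (simp add: Nats_add)
    qed simp
    then show ?thesis by blast
  qed
  finally show ?case .
qed

text \<open>Entries of the powers are natural numbers, so positive ones are at least 1 and each row
  sums to at least m.\<close>

lemma primitive_mat_power_sum_ge:
  fixes A :: "real mat"
  assumes m: "m \<ge> 2" and A: "A \<in> carrier_mat m m"
    and Nats: "\<And>i j. i < m \<Longrightarrow> j < m \<Longrightarrow> A $$ (i, j) \<in> \<nat>" and prim: "primitive_mat A"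
  obtains k where "k > 0" "\<And>i. i < m \<Longrightarrow> (A ^\<^sub>m k *\<^sub>v ones_vec m) $ i \<ge> real m"
proof -
  obtain k where k: "\<And>i j. i < m \<Longrightarrow> j < m \<Longrightarrow> (A ^\<^sub>m k) $$ (i, j) > 0"
    using prim unfolding primitive_mat_def carrier_matD[OF A] by blast
  \<comment> \<open>The zeroth power is the identity, which has a zero entry off the diagonal since
    m is at least 2.\<close>
  have "k \<noteq> 0"
  proof
    assume "k = 0"
    then show False using k[of 0 1] m A by simp
  qed
  moreover have "(A ^\<^sub>m k *\<^sub>v ones_vec m) $ i \<ge> real m" if i: "i < m" for i
  proof -
    have "(A ^\<^sub>m k) $$ (i, j) \<ge> 1" if j: "j < m" for j
      using pow_mat_Nats[OF A Nats i j, of k] k[OF i j] by (auto elim!: Nats_cases)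
    then have "(\<Sum>j<m. 1) \<le> (\<Sum>j<m. (A ^\<^sub>m k) $$ (i, j))" by (intro sum_mono) auto
    then show ?thesis by (simp add: pow_mat_ones_index[OF A i])
  qed
  ultimately show ?thesis using that by blast
qed

lemma eigenvector_ones_iff:
  fixes A :: "real mat"
  assumes A: "A \<in> carrier_mat m m" and "m > 0"
  shows "eigenvector A (ones_vec m) c \<longleftrightarrow> (\<forall>i<m. (\<Sum>j<m. A $$ (i, j)) = c)"
proof -
  have "ones_vec m \<noteq> 0\<^sub>v m"
  proof
    assume "ones_vec m = 0\<^sub>v m"
    then have "ones_vec m $ 0 = 0\<^sub>v m $ 0" by simp
    then show False using assms(2) by (simp add: ones_vec_def)
  qed
  moreover have "A *\<^sub>v ones_vec m = c \<cdot>\<^sub>v ones_vec m \<longleftrightarrow> (\<forall>i<m. (\<Sum>j<m. A $$ (i, j)) = c)"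
    using A by (auto simp: vec_eq_iff ones_vec_def scalar_prod_def atLeast0LessThan)
  ultimately show ?thesis using A by (auto simp: eigenvector_def ones_vec_def)
qed

theorem theorem1p3:
  fixes m q :: nat and A :: "real mat"
  assumes "m \<ge> 2" and "q \<ge> 2"
    and "A \<in> carrier_mat m m"
    and "\<forall>i<m. \<forall>j<m. A $$ (i,j) \<in> {0, 1}"
    and "primitive_mat A"
  shows "(\<exists>!t. t \<in> carrier_vec m \<and>
            (\<forall>i<m. t $ i > 1 \<and> t $ i ^ q = (\<Sum>j<m. A $$ (i,j) * t $ j)))
       \<and> (\<forall>t. t \<in> carrier_vec m \<and>
            (\<forall>i<m. t $ i > 1 \<and> t $ i ^ q = (\<Sum>j<m. A $$ (i,j) * t $ j)) \<longrightarrow>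
            hausdorff_dim m (X_A m q A) = (real q - 1) / real q * log m (\<Sum>i<m. t $ i))
       \<and> minkowski_dim_eq m (X_A m q A)
            ((real q - 1)^2 * (\<Sum>k. log m ((A ^\<^sub>m k *\<^sub>v ones_vec m) \<bullet> ones_vec m) / real q ^ (k + 2)))
       \<and> (hausdorff_dim m (X_A m q A) =
            (real q - 1)^2 * (\<Sum>k. log m ((A ^\<^sub>m k *\<^sub>v ones_vec m) \<bullet> ones_vec m) / real q ^ (k + 2))
          \<longleftrightarrow> (\<exists>c. eigenvector A (ones_vec m) c))"
proof -
  define a where "a = (\<lambda>i j. A $$ (i, j))"
  have a01: "a i j = 0 \<or> a i j = 1" if "i < m" "j < m" for i j using assms(4) that by (auto simp: a_def)
  have Nats: "A $$ (i, j) \<in> \<nat>" if "i < m" "j < m" for i j using a01[OF that] by (auto simp: a_def)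
  obtain k0 where k0: "k0 > 0" "\<And>i. i < m \<Longrightarrow> (A ^\<^sub>m k0 *\<^sub>v ones_vec m) $ i \<ge> real m"
    using primitive_mat_power_sum_ge[OF assms(1,3) Nats assms(5)] by blast
  \<comment> \<open>A zero row of A would give a zero row in every positive power, contradicting the
    row sums for k0.\<close>
  have row: "\<exists>j<m. a i j = 1" if i: "i < m" for i
  proof (rule ccontr)
    assume "\<not> ?thesis"
    then have "a i j = 0" if "j < m" for j using a01[OF i that] that by blast
    then have "(A ^\<^sub>m Suc (k0 - 1) *\<^sub>v ones_vec m) $ i = 0"
      unfolding pow_mat_ones_Suc_index[OF assms(3) i] by (intro sum.neutral) (auto simp: a_def)
    then show False using k0(2)[OF i] k0(1) assms(1) by simp
  qed
  interpret mult_shift m q a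
    by unfold_locales (use assms(1,2) a01 row in auto)
  have X: "X_A m q A = X" unfolding X_A_def X_def by (simp add: a_def)
  have walks: "(A ^\<^sub>m k *\<^sub>v ones_vec m) $ i = walks k i" if "i < m" for k i
    using that
  proof (induction k arbitrary: i)
    case 0
    then show ?case using assms(3) by (simp add: ones_vec_def)
  next
    case (Suc k)
    have "A $$ (i, j) = a i j" for j by (simp add: a_def)
    then show ?case unfolding pow_mat_ones_Suc_index[OF assms(3) Suc.prems] using Suc.IH by simp
  qed
  have total: "(A ^\<^sub>m k *\<^sub>v ones_vec m) \<bullet> ones_vec m = walks_total k" for k
    using walks by (simp add: scalar_prod_def ones_vec_def walks_total_def atLeast0LessThan)
  have mdim: "(real q - 1)^2 * (\<Sum>k. log m ((A ^\<^sub>m k *\<^sub>v ones_vec m) \<bullet> ones_vec m) / real q ^ (k + 2)) = mdim"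
    by (simp add: mdim_def total)
  \<comment> \<open>At k0 there are at least m, hence at least two, walks from every letter; this is
    the branching that yields \<open>t i > 1\<close>.\<close>
  have "\<exists>k. walks k i \<noteq> 1" if "i < m" for i
    using k0(2)[OF that] assms(1) unfolding walks[OF that] by (intro exI[of _ k0]) auto
  then obtain s where s: "\<And>i. i < m \<Longrightarrow> s i > 1" "\<And>i. i < m \<Longrightarrow> s i ^ q = (\<Sum>j<m. a i j * s j)"
    using ex_solution by blast
  have sol: "mult_shift_solution m q a (\<lambda>i. t $ i)"
    if "\<forall>i<m. t $ i > 1 \<and> t $ i ^ q = (\<Sum>j<m. A $$ (i,j) * t $ j)" for t
    by unfold_locales (use that in \<open>auto simp: a_def\<close>)
  interpret s: mult_shift_solution m q a s by unfold_locales (use s in auto)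
  have hdim: "hausdorff_dim m X = (real q - 1) / real q * log m (\<Sum>i<m. t $ i)"
    if "\<forall>i<m. t $ i > 1 \<and> t $ i ^ q = (\<Sum>j<m. A $$ (i,j) * t $ j)" for t
  proof -
    interpret t: mult_shift_solution m q a "\<lambda>i. t $ i" using sol[OF that] .
    show ?thesis using t.hausdorff_dim_X by (simp add: t.hdim_def t.T_def)
  qed
  have uniq: "t $ i \<le> t' $ i"
    if t: "\<forall>i<m. t $ i > 1 \<and> t $ i ^ q = (\<Sum>j<m. A $$ (i,j) * t $ j)"
      and t': "\<forall>i<m. t' $ i > 1 \<and> t' $ i ^ q = (\<Sum>j<m. A $$ (i,j) * t' $ j)" and i: "i < m"
    for t t' :: "real vec" and i
  proof (rule subsolution_le_supersolution[OF _ _ _ _ i, of "\<lambda>i. t $ i" "\<lambda>i. t' $ i"])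
    show "t $ j > 0" if "j < m" for j using t that by force
    show "t' $ j > 0" if "j < m" for j using t' that by force
  qed (use t t' in \<open>auto simp: a_def\<close>)
  have "\<exists>!t. t \<in> carrier_vec m \<and> (\<forall>i<m. t $ i > 1 \<and> t $ i ^ q = (\<Sum>j<m. A $$ (i,j) * t $ j))"
  proof (rule ex_ex1I)
    show "\<exists>t. t \<in> carrier_vec m \<and> (\<forall>i<m. t $ i > 1 \<and> t $ i ^ q = (\<Sum>j<m. A $$ (i,j) * t $ j))"
      using s by (intro exI[of _ "vec m s"]) (simp add: a_def)
    fix t t' :: "real vec"
    assume "t \<in> carrier_vec m \<and> (\<forall>i<m. t $ i > 1 \<and> t $ i ^ q = (\<Sum>j<m. A $$ (i,j) * t $ j))"
      and "t' \<in> carrier_vec m \<and> (\<forall>i<m. t' $ i > 1 \<and> t' $ i ^ q = (\<Sum>j<m. A $$ (i,j) * t' $ j))"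
    then show "t = t'" using uniq[of t t'] uniq[of t' t] by (intro eq_vecI) (auto intro: antisym)
  qed
  moreover have "hausdorff_dim m X = mdim \<longleftrightarrow> (\<exists>c. eigenvector A (ones_vec m) c)"
    using s.hdim_eq_mdim_iff by (simp only: s.hausdorff_dim_X eigenvector_ones_iff[OF assms(3) m_pos]) (simp only: a_def)
  ultimately show ?thesis unfolding X mdim using hdim minkowski_dim_mdim by blast
qed

end
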